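(* Let $p$ be an odd prime and let $a$ be a positive integer. Let $h\in\mathbb{Z}_p$ be a $p$-adic integer with $h\not\equiv 0\pmod p$, and suppose that $2h\not\equiv 1\pmod p$ or $p^a>3$. Then $$\sum_{k=0}^{p^a-1}\binom{hp^a-1}{k}\binom{2k}{k}\left(-\frac h2\right)^k\equiv\left(\frac{1-2h}{p^a}\right)\left(1+h\left(\left(4-\frac 2h\right)^{p-1}-1\right)\right)\pmod{p^2}.$$
   Context: $\mathbb{Z}_p$ is the ring of $p$-adic integers, and congruences modulo $p^2$ are taken in $\mathbb{Z}_p$. For $x\in\mathbb{Z}_p$ and $k\in\{0,1,2,\dots\}$, $\binom xk=\prod_{j=1}^{k}\frac{x-j+1}{j}$. $(-)$ is the Jacobi symbol: for $x\in\mathbb{Z}_p$, $\left(\frac{x}{p^a}\right)=\left(\frac{x}{p}\right)^a$, where $\left(\frac xp\right)\in\{0,1,-1\}$ is the Legendre symbol of the residue class of $x$ modulo $p$ (equal to $0$ when $p\mid x$). *)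

theory Defs
  imports
    "Berlekamp_Zassenhaus.Finite_Field"
    "HOL-Computational_Algebra.Polynomial_Factorial"
    "HOL-Number_Theory.Residues"
begin

text \<open>
  The prime \<open>p\<close> is carried by a type \<open>'p\<close> with \<open>p = CARD('p)\<close>. The ring of \<open>p\<close>-adic integers is the
  inverse limit of the rings \<open>\<int>/p\<^sup>n\<int>\<close>: an element is the sequence of its residues modulo \<open>p\<^sup>n\<close>, each
  represented in \<open>{0..<p ^ n}\<close> (the coherence condition below enforces this range).
\<close>

typedef ('p::prime_card) padic_int =
  "{x :: nat \<Rightarrow> int. \<forall>n. x n = x (Suc n) mod int CARD('p) ^ n}"
  by (rule exI[of _ "\<lambda>_. 0"]) simp

setup_lifting type_definition_padic_int

lemma prime_int_card: "prime (int CARD('p::prime_card))"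
  using prime_card by simp

lemma Rep_padic_int_Suc:
  "Rep_padic_int (x :: 'p::prime_card padic_int) (Suc n) mod int CARD('p) ^ n = Rep_padic_int x n"
  by (rule sym) (rule Rep_padic_int[of x, unfolded mem_Collect_eq, rule_format])

lemma Rep_padic_int_mod:
  fixes x :: "'p::prime_card padic_int"
  assumes "m \<le> n"
  shows "Rep_padic_int x n mod int CARD('p) ^ m = Rep_padic_int x m"
  using assms
proof (induction n rule: dec_induct)
  case base
  show ?case by (metis Rep_padic_int_Suc mod_mod_trivial)
next
  case (step n)
  have "int CARD('p) ^ m dvd int CARD('p) ^ n"
    using step by (simp add: le_imp_power_dvd)
  then have "Rep_padic_int x (Suc n) mod int CARD('p) ^ m
      = Rep_padic_int x (Suc n) mod int CARD('p) ^ n mod int CARD('p) ^ m"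
    by (simp add: mod_mod_cancel)
  with step show ?case by (simp add: Rep_padic_int_Suc)
qed

lemma padic_int_eqI: "(\<And>n. Rep_padic_int x n = Rep_padic_int y n) \<Longrightarrow> x = y"
  by (rule Rep_padic_int_inject[THEN iffD1], rule ext)

lemma coherent_mod:
  fixes f :: "nat \<Rightarrow> int" and P :: int
  assumes "\<And>n. f n mod P ^ n = f (Suc n) mod P ^ n"
  shows "f n mod P ^ n = f (Suc n) mod P ^ Suc n mod P ^ n"
proof -
  have "P ^ n dvd P ^ Suc n" by simp
  then have "f (Suc n) mod P ^ Suc n mod P ^ n = f (Suc n) mod P ^ n"
    by (rule mod_mod_cancel)
  with assms[of n] show ?thesis by simp
qed

lemma coherent_mod_self:
  fixes f :: "nat \<Rightarrow> int" and P :: int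
  assumes "\<And>n. f n = f (Suc n) mod P ^ n"
  shows "f n mod P ^ n = f (Suc n) mod P ^ n" "f n mod P ^ n = f n"
  using mod_mod_trivial[of "f (Suc n)" "P ^ n"] unfolding assms[of n, symmetric] by simp_all

instantiation padic_int :: (prime_card) comm_ring_1
begin

lift_definition zero_padic_int :: "'a padic_int" is "\<lambda>_. 0" by simp

lift_definition one_padic_int :: "'a padic_int" is "\<lambda>n. 1 mod int CARD('a) ^ n"
  by (rule coherent_mod) simp

lift_definition plus_padic_int :: "'a padic_int \<Rightarrow> 'a padic_int \<Rightarrow> 'a padic_int"
  is "\<lambda>x y n. (x n + y n) mod int CARD('a) ^ n"
  by (rule coherent_mod, rule mod_add_cong) (rule coherent_mod_self, assumption)+

lift_definition times_padic_int :: "'a padic_int \<Rightarrow> 'a padic_int \<Rightarrow> 'a padic_int"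
  is "\<lambda>x y n. (x n * y n) mod int CARD('a) ^ n"
  by (rule coherent_mod, rule mod_mult_cong) (rule coherent_mod_self, assumption)+

lift_definition uminus_padic_int :: "'a padic_int \<Rightarrow> 'a padic_int"
  is "\<lambda>x n. (- x n) mod int CARD('a) ^ n"
  by (rule coherent_mod, rule mod_minus_cong) (rule coherent_mod_self, assumption)

lift_definition minus_padic_int :: "'a padic_int \<Rightarrow> 'a padic_int \<Rightarrow> 'a padic_int"
  is "\<lambda>x y n. (x n - y n) mod int CARD('a) ^ n"
  by (rule coherent_mod, rule mod_diff_cong) (rule coherent_mod_self, assumption)+

lemmas Rep_padic_int_ops = zero_padic_int.rep_eq one_padic_int.rep_eq plus_padic_int.rep_eq
  times_padic_int.rep_eq uminus_padic_int.rep_eq minus_padic_int.rep_eq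

instance
proof
  fix a b c :: "'a padic_int"
  have self: "Rep_padic_int x n mod int CARD('a) ^ n = Rep_padic_int x n" for x :: "'a padic_int" and n
    by (simp add: Rep_padic_int_mod)
  show "a * b * c = a * (b * c)"
    by (rule padic_int_eqI) (simp add: Rep_padic_int_ops mod_simps mult.assoc)
  show "a * b = b * a"
    by (rule padic_int_eqI) (simp add: Rep_padic_int_ops mult.commute)
  show "1 * a = a"
    by (rule padic_int_eqI) (simp add: Rep_padic_int_ops mod_simps self)
  show "a + b + c = a + (b + c)"
    by (rule padic_int_eqI) (simp add: Rep_padic_int_ops mod_simps add.assoc)
  show "a + b = b + a"
    by (rule padic_int_eqI) (simp add: Rep_padic_int_ops add.commute)
  show "0 + a = a"
    by (rule padic_int_eqI) (simp add: Rep_padic_int_ops self)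
  show "- a + a = 0"
    by (rule padic_int_eqI) (simp add: Rep_padic_int_ops mod_simps)
  show "a - b = a + - b"
    by (rule padic_int_eqI) (simp add: Rep_padic_int_ops mod_simps)
  show "(a + b) * c = a * c + b * c"
    by (rule padic_int_eqI) (simp add: Rep_padic_int_ops mod_simps distrib_right)
  have "1 < int CARD('a)" using prime_int_card prime_gt_1_int by blast
  then have "Rep_padic_int (1 :: 'a padic_int) 1 \<noteq> Rep_padic_int 0 1"
    by (simp add: Rep_padic_int_ops)
  then show "(0 :: 'a padic_int) \<noteq> 1" by metis
qed

end

lemma Rep_padic_int_eq_0_iff: "x = 0 \<longleftrightarrow> (\<forall>n. Rep_padic_int x n = 0)"
  by (auto simp: zero_padic_int.rep_eq intro: padic_int_eqI)

lemma Rep_padic_int_of_nat: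
  "Rep_padic_int (of_nat k :: 'p::prime_card padic_int) n = int k mod int CARD('p) ^ n"
proof (induction k)
  case 0
  show ?case by (simp add: zero_padic_int.rep_eq)
next
  case (Suc k)
  then show ?case by (simp add: plus_padic_int.rep_eq one_padic_int.rep_eq mod_simps)
qed

instance padic_int :: (prime_card) idom
proof
  fix x y :: "'a padic_int"
  let ?P = "int CARD('a)"
  assume "x \<noteq> 0" "y \<noteq> 0"
  then obtain i j where ij: "Rep_padic_int x i \<noteq> 0" "Rep_padic_int y j \<noteq> 0"
    by (auto simp: Rep_padic_int_eq_0_iff)
  define u v where "u = Rep_padic_int x (i + j)" and "v = Rep_padic_int y (i + j)"
  have "u mod ?P ^ i \<noteq> 0" "v mod ?P ^ j \<noteq> 0"
    using ij by (simp_all add: u_def v_def Rep_padic_int_mod)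
  then have ndvd: "\<not> ?P ^ i dvd u" "\<not> ?P ^ j dvd v"
    by (simp_all add: dvd_eq_mod_eq_0)
  then have nz: "u \<noteq> 0" "v \<noteq> 0" by auto
  have pr: "prime_elem ?P" using prime_int_card by blast
  then have nu: "\<not> is_unit ?P" by auto
  have "multiplicity ?P u < i" "multiplicity ?P v < j"
    using ndvd nz nu by (simp_all add: power_dvd_iff_le_multiplicity)
  then have "multiplicity ?P (u * v) < i + j"
    using nz pr by (simp add: prime_elem_multiplicity_mult_distrib)
  then have "\<not> ?P ^ (i + j) dvd u * v"
    using nz nu by (simp add: power_dvd_iff_le_multiplicity)
  then have "Rep_padic_int (x * y) (i + j) \<noteq> 0"
    by (simp add: times_padic_int.rep_eq u_def v_def dvd_eq_mod_eq_0)
  then show "x * y \<noteq> 0" by (auto simp: Rep_padic_int_eq_0_iff)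
qed

instance padic_int :: (prime_card) ring_char_0
proof
  show "inj (of_nat :: nat \<Rightarrow> 'a padic_int)"
  proof (rule injI)
    fix m n :: nat
    let ?P = "int CARD('a)"
    assume eq: "(of_nat m :: 'a padic_int) = of_nat n"
    have "1 < CARD('a)" using prime_card prime_gt_1_nat by blast
    then have "m + n < CARD('a) ^ (m + n)" by (simp add: power_gt_expt)
    then have "int m < ?P ^ (m + n)" "int n < ?P ^ (m + n)"
      by (simp_all flip: of_nat_power)
    moreover have "int m mod ?P ^ (m + n) = int n mod ?P ^ (m + n)"
      using eq by (metis Rep_padic_int_of_nat)
    ultimately show "m = n" by simp
  qed
qed

instance fract :: ("{idom, ring_char_0}") field_char_0
proof
  show "inj (of_nat :: nat \<Rightarrow> 'a fract)"
    by (rule injI) (simp add: of_nat_fract eq_fract)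
qed

text \<open>The field of \<open>p\<close>-adic numbers; \<^const>\<open>to_fract\<close> is the inclusion of the \<open>p\<close>-adic integers.\<close>

type_synonym 'p padic = "'p padic_int fract"

text \<open>
  Congruence modulo \<open>m\<close> in the ring of \<open>p\<close>-adic integers, for elements written in the fraction field;
  that both sides are \<open>p\<close>-adic integers is part of the definition.
\<close>

definition padic_cong :: "'p::prime_card padic \<Rightarrow> 'p padic \<Rightarrow> nat \<Rightarrow> bool" where
  "padic_cong x y m \<longleftrightarrow>
    (\<exists>u v :: 'p padic_int. x = to_fract u \<and> y = to_fract v \<and> of_nat m dvd u - v)"

text \<open>The symbol \<open>(x / p\<^sup>a)\<close>; component \<open>1\<close> of \<open>x\<close> is its residue modulo \<open>p\<close>.\<close>

definition padic_Jacobi :: "'p::prime_card padic_int \<Rightarrow> nat \<Rightarrow> int" where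
  "padic_Jacobi x a = Legendre (Rep_padic_int x 1) (int CARD('p)) ^ a"

end

theory Submission
  imports Defs "HOL-Computational_Algebra.Formal_Power_Series"
    "HOL-Number_Theory.Modular_Inverse" "HOL-Number_Theory.Euler_Criterion"
begin

text \<open>
  Put \<open>q = p\<^sup>a = 2m + 1\<close>, \<open>d = 1 - 2h\<close>, \<open>H\<^sub>k = \<Sum>\<^bsub>j\<le>k\<^esub> q/j\<close>. Since \<open>p\<close> divides \<open>q/j\<close> for \<open>0 < j < q\<close>, one has
  \<open>(-1)\<^sup>k binom(hq-1, k) \<equiv> 1 - h H\<^sub>k\<close> modulo \<open>p\<^sup>2\<close>, so the sum is \<open>A - hB\<close> with
  \<open>A = \<Sum> binom(2k, k) (h/2)\<^sup>k\<close> and \<open>B = \<Sum> binom(2k, k) (h/2)\<^sup>k H\<^sub>k\<close>. An exact identity expands \<open>A\<close> in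
  powers of \<open>d\<close>; as \<open>p\<close> divides \<open>H\<^sub>k\<close>, in \<open>B\<close> one may replace \<open>binom(2k, k)\<close> by \<open>binom(m, k) (-4)\<^sup>k\<close>, and
  then \<open>B\<close> is an exact sum too. For this particular argument \<open>h/2\<close> the terms combine to
  \<open>\<Sum>\<^bsub>0<i\<le>m\<^esub> (q/i) (d\<^bsup>m+i\<^esup> - d\<^bsup>m+1-i\<^esup>)\<close>, which by \<open>i \<mapsto> q - i\<close> is
  \<open>d\<^sup>m \<Sum>\<^bsub>0<i<q\<^esub> (q/i) d\<^sup>i \<equiv> d\<^sup>m (1 - d\<^sup>q - (1 - d)\<^sup>q)\<close> when \<open>p\<close> does not divide \<open>d\<close>. What remains are the Fermat
  quotients of \<open>2\<close>, \<open>d\<close>, \<open>h\<close> and \<open>d\<^sup>m\<close>, the latter determined modulo \<open>p\<^sup>2\<close> by its sign and its square.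
  If \<open>p\<close> divides \<open>d\<close>, every term is divisible by \<open>p\<^sup>2\<close>, provided that \<open>m \<ge> 2\<close>.
\<close>

subsection \<open>Exact identities for binomial sums\<close>

lemma Suc_times_central_binomial:
  "Suc n * (2 * Suc n choose Suc n) = 2 * (2 * n + 1) * (2 * n choose n)"
proof -
  have "Suc n * (2 * Suc n choose Suc n) = (2 * n + 2) * (Suc (2 * n) choose n)"
    using Suc_times_binomial_eq[of "Suc (2 * n)" n] by (simp add: mult.commute)
  also have "Suc (2 * n) choose n = Suc (2 * n) choose Suc n"
    using binomial_symmetric[of n "Suc (2 * n)"] by simp
  also have "(2 * n + 2) * (Suc (2 * n) choose Suc n) = 2 * (Suc n * (Suc (2 * n) choose Suc n))"
    by simp
  also have "Suc n * (Suc (2 * n) choose Suc n) = Suc (2 * n) * (2 * n choose n)"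
    using Suc_times_binomial_eq[of "2 * n" n] by (simp add: mult.commute)
  finally show ?thesis by simp
qed

lemma Suc_times_gbinomial_Suc:
  fixes a :: "'a::field_char_0"
  shows "of_nat (Suc k) * (a gchoose Suc k) = (a - of_nat k) * (a gchoose k)"
  using gbinomial_absorption[of k a] gbinomial_absorb_comp[of a k] by simp

text \<open>With \<open>q = 2 * m + 1\<close> one has \<open>-1/2 = m - q/2\<close>, so this formula
  links central binomial coefficients with \<open>m choose k\<close> modulo
  \<open>p\<close>.\<close>

lemma gbinomial_minus_half:
  "((- 1 / 2 :: 'a::field_char_0) gchoose k) * (- 4) ^ k = of_nat (2 * k choose k)"
proof (induction k)
  case (Suc k)
  let ?a = "- 1 / 2 :: 'a"
  have "of_nat (Suc k) * ((?a gchoose Suc k) * (- 4) ^ Suc k)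
      = (of_nat (Suc k) * (?a gchoose Suc k)) * (- 4) ^ Suc k" by (simp only: mult.assoc)
  also have "\<dots> = (?a - of_nat k) * (- 4) * ((?a gchoose k) * (- 4) ^ k)"
    by (simp only: Suc_times_gbinomial_Suc power_Suc ac_simps)
  also have "\<dots> = of_nat (2 * (2 * k + 1) * (2 * k choose k))"
    unfolding Suc.IH by (simp add: field_simps)
  also have "\<dots> = of_nat (Suc k) * of_nat (2 * Suc k choose Suc k)"
    by (simp only: Suc_times_central_binomial[symmetric] of_nat_mult)
  finally show ?case by (simp only: mult_cancel_left of_nat_eq_0_iff nat.simps) simp
qed simp

text \<open>
  Up to the factor \<open>n\<close>, the right-hand sum is \<open>\<integral>\<^sub>0\<^sup>1 (1 - d s\<^sup>2)\<^bsup>n-1\<^esup> ds\<close>; the recurrence behind the induction is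
  integration by parts.
\<close>

lemma sum_central_binomial:
  fixes x :: "'a::field_char_0"
  assumes "n > 0" and d: "d = 1 - 4 * x"
  shows "2 * 4 ^ (n - 1) * (\<Sum>k<n. of_nat (2 * k choose k) * x ^ k)
    = of_nat (2 * n choose n) * (\<Sum>j<n. of_nat (n - 1 choose j) * (- d) ^ j * (of_nat n / of_nat (2 * j + 1)))"
proof -
  define J where "J n = (\<Sum>j<n. of_nat (n - 1 choose j) * (- d) ^ j / of_nat (2 * j + 1))" for n
  \<comment> \<open>Integration by parts, coefficient by coefficient:
    \<open>2n + 1 = (2j + 1) + 2(n - j)\<close>, and absorption turns
    \<open>(n - j) * (n choose j)\<close> into \<open>n * (n - 1 choose j)\<close>.\<close>
  have coeff: "of_nat (2 * n + 1) * (of_nat (n choose j) / of_nat (2 * j + 1))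
      = (of_nat (n choose j) + 2 * of_nat n * (of_nat (n - 1 choose j) / of_nat (2 * j + 1)) :: 'a)"
    if "n > 0" "j \<le> n" for n j
  proof -
    have "(n - j) * (n choose j) = n * (n - 1 choose j)"
      using that binomial_absorb_comp[of n j] by simp
    then have "(of_nat n - of_nat j) * of_nat (n choose j) = (of_nat n * of_nat (n - 1 choose j) :: 'a)"
      using that by (metis of_nat_diff of_nat_mult)
    moreover have "(of_nat (2 * j + 1) :: 'a) \<noteq> 0" by (simp only: of_nat_eq_0_iff)
    moreover have "of_nat (2 * n + 1) * c = of_nat (2 * j + 1) * c + 2 * ((of_nat n - of_nat j) * c)"
      for c :: 'a by (simp add: algebra_simps)
    moreover have "u * (c / e) = c + 2 * v * (b / e)" if "u * c = e * c + 2 * (v * b)" "e \<noteq> 0"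
      for u v b c e :: 'a using that by (simp add: field_simps)
    ultimately show ?thesis by metis
  qed
  have J_Suc: "of_nat (2 * n + 1) * J (Suc n) = (1 - d) ^ n + 2 * of_nat n * J n" if "n > 0" for n
  proof -
    have "of_nat (2 * n + 1) * J (Suc n)
        = (\<Sum>j\<le>n. of_nat (2 * n + 1) * (of_nat (n choose j) / of_nat (2 * j + 1)) * (- d) ^ j)"
      unfolding J_def by (simp add: sum_distrib_left lessThan_Suc_atMost mult_ac)
    also have "\<dots> = (\<Sum>j\<le>n. of_nat (n choose j) * (- d) ^ j
        + 2 * of_nat n * (of_nat (n - 1 choose j) * (- d) ^ j / of_nat (2 * j + 1)))"
      by (intro sum.cong refl) (simp only: coeff[OF that] atMost_iff, simp add: algebra_simps)
    also have "\<dots> = (\<Sum>j\<le>n. of_nat (n choose j) * (- d) ^ j)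
        + 2 * of_nat n * (\<Sum>j\<le>n. of_nat (n - 1 choose j) * (- d) ^ j / of_nat (2 * j + 1))"
      by (simp add: sum.distrib sum_distrib_left)
    also have "(\<Sum>j\<le>n. of_nat (n choose j) * (- d) ^ j) = (1 - d) ^ n"
      using binomial_ring[of "- d" 1 n] by (simp add: mult_ac)
    \<comment> \<open>The additional term \<open>j = n\<close> vanishes because
      \<open>n - 1 choose n = 0\<close> for \<open>n > 0\<close>.\<close>
    also have "(\<Sum>j\<le>n. of_nat (n - 1 choose j) * (- d) ^ j / of_nat (2 * j + 1)) = J n"
      using that unfolding J_def lessThan_Suc_atMost[symmetric] sum.lessThan_Suc by simp
    finally show ?thesis .
  qed
  have "2 * 4 ^ n * (\<Sum>k<Suc n. of_nat (2 * k choose k) * x ^ k)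
      = of_nat (2 * Suc n choose Suc n) * (of_nat (Suc n) * J (Suc n))" for n
  proof (induction n)
    case 0
    show ?case by (simp add: J_def)
  next
    case (Suc n)
    let ?N = "Suc n" and ?c = "of_nat (2 * Suc n choose Suc n) :: 'a"
    have "of_nat (2 * Suc ?N choose Suc ?N) * (of_nat (Suc ?N) * J (Suc ?N))
        = of_nat (Suc ?N * (2 * Suc ?N choose Suc ?N)) * J (Suc ?N)"
      by (simp only: of_nat_mult ac_simps)
    also have "\<dots> = 2 * ?c * (of_nat (2 * ?N + 1) * J (Suc ?N))"
      unfolding Suc_times_central_binomial by (simp only: of_nat_mult ac_simps of_nat_numeral)
    also have "\<dots> = 2 * ?c * (1 - d) ^ ?N + 4 * (?c * (of_nat ?N * J ?N))"
      by (subst J_Suc) (simp_all add: algebra_simps del: of_nat_Suc)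
    \<comment> \<open>Since \<open>1 - d = 4 * x\<close>, the boundary term of the recurrence is
      exactly the next summand, \<open>k = Suc n\<close>.\<close>
    also have "\<dots> = 2 * ?c * (4 * x) ^ ?N
        + 4 * (2 * 4 ^ n * (\<Sum>k<?N. of_nat (2 * k choose k) * x ^ k))"
      unfolding Suc.IH d by simp
    also have "\<dots> = 2 * 4 ^ ?N * (\<Sum>k<Suc ?N. of_nat (2 * k choose k) * x ^ k)"
      by (simp add: power_mult_distrib algebra_simps)
    finally show ?case ..
  qed
  from this[of "n - 1"] \<open>n > 0\<close> show ?thesis
    by (simp add: J_def sum_distrib_left mult_ac)
qed

text \<open>Pascal's rule reduces the sum for \<open>Suc m\<close> to \<open>1 + y\<close> times the
  sum for \<open>m\<close>, plus a remainder that absorption turns into a binomial expansion. With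
  \<open>y = -4 * x\<close>, so that \<open>1 + y = d\<close>, this evaluates
  \<open>B\<close>.\<close>

lemma sum_binomial_harmonic:
  fixes y :: "'a::field_char_0"
  shows "(\<Sum>k\<le>m. of_nat (m choose k) * y ^ k * (\<Sum>j=1..k. 1 / of_nat j))
    = (\<Sum>j=1..m. ((1 + y) ^ m - (1 + y) ^ (m - j)) / of_nat j)"
proof (induction m)
  case (Suc m)
  define H :: "nat \<Rightarrow> 'a" where "H k = (\<Sum>j=1..k. 1 / of_nat j)" for k
  define L where "L m = (\<Sum>k\<le>m. of_nat (m choose k) * y ^ k * H k)" for m
  have absorb: "of_nat (m choose k) / of_nat (Suc k) = (of_nat (Suc m choose Suc k) / of_nat (Suc m) :: 'a)" for k
  proof -
    have "(of_nat (Suc k) * of_nat (Suc m choose Suc k) :: 'a) = of_nat (Suc m) * of_nat (m choose k)"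
      by (metis Suc_times_binomial_eq mult.commute of_nat_mult)
    then show ?thesis by (simp add: field_simps del: of_nat_Suc binomial_Suc_Suc)
  qed
  have "L (Suc m) = (\<Sum>k\<le>m. of_nat (Suc m choose Suc k) * y ^ Suc k * H (Suc k))"
    unfolding L_def sum.atMost_Suc_shift by (simp add: H_def)
  also have "\<dots> = (\<Sum>k\<le>m. of_nat (m choose Suc k) * y ^ Suc k * H (Suc k))
      + (\<Sum>k\<le>m. of_nat (m choose k) * y ^ Suc k * H (Suc k))"
    by (simp add: sum.distrib[symmetric] algebra_simps)
  also have "(\<Sum>k\<le>m. of_nat (m choose Suc k) * y ^ Suc k * H (Suc k)) = L m"
    using sum.atMost_Suc_shift[of "\<lambda>k. of_nat (m choose k) * y ^ k * H k" m]
    unfolding L_def sum.atMost_Suc by (simp add: H_def binomial_eq_0)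
  also have "(\<Sum>k\<le>m. of_nat (m choose k) * y ^ Suc k * H (Suc k))
      = y * L m + (\<Sum>k\<le>m. of_nat (m choose k) / of_nat (Suc k) * y ^ Suc k)"
    unfolding L_def by (simp add: sum.distrib[symmetric] sum_distrib_left algebra_simps H_def)
  also have "(\<Sum>k\<le>m. of_nat (m choose k) / of_nat (Suc k) * y ^ Suc k)
      = (\<Sum>k\<le>m. of_nat (Suc m choose Suc k) * y ^ Suc k) / of_nat (Suc m)"
    unfolding absorb by (simp add: sum_divide_distrib)
  also have "(\<Sum>k\<le>m. of_nat (Suc m choose Suc k) * y ^ Suc k) = (1 + y) ^ Suc m - 1"
    using binomial_ring[of y 1 "Suc m"] unfolding sum.atMost_Suc_shift
    by (simp add: add.commute del: binomial_Suc_Suc power_Suc)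
  \<comment> \<open>The last quotient is the summand \<open>j = Suc m\<close> of the claim, where
    the exponent \<open>Suc m - j\<close> is 0.\<close>
  finally have "L (Suc m) = (1 + y) * L m + ((1 + y) ^ Suc m - 1) / of_nat (Suc m)"
    by (simp add: algebra_simps)
  also have "(1 + y) * L m = (\<Sum>j=1..m. ((1 + y) ^ Suc m - (1 + y) ^ (Suc m - j)) / of_nat j)"
    using Suc.IH unfolding L_def H_def
    by (simp add: sum_distrib_left Suc_diff_le right_diff_distrib)
  finally show ?case unfolding L_def H_def by simp
qed simp

subsection \<open>Arithmetic of the \<open>p\<close>-adic integers\<close>

text \<open>The ideal generated by \<open>p^n\<close>, taken inside the field of p-adic numbers:
  quotients such as \<open>h / 2\<close> and \<open>q / j\<close> can be formed freely, and
  \<open>padic_ideal 0\<close> expresses integrality.\<close>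

definition padic_ideal :: "nat \<Rightarrow> 'p::prime_card padic set" where
  "padic_ideal n = range (\<lambda>u. to_fract (of_nat CARD('p) ^ n * u))"

lemma to_fract_of_nat [simp]: "to_fract (of_nat n) = of_nat n"
  by (induction n) simp_all

lemma to_fract_of_int [simp]: "to_fract (of_int n) = of_int n"
  by (cases n) simp_all

lemma to_fract_numeral [simp]: "to_fract (numeral n) = numeral n"
  using to_fract_of_nat[of "numeral n"] by simp

lemma to_fract_power [simp]: "to_fract (x ^ n) = to_fract x ^ n"
  by (induction n) simp_all

lemma padic_idealE:
  assumes "x \<in> (padic_ideal n :: 'p::prime_card padic set)"
  obtains u where "x = of_nat CARD('p) ^ n * to_fract u"
  using assms by (auto simp: padic_ideal_def)

lemma padic_idealI: "x = of_nat CARD('p) ^ n * to_fract u \<Longrightarrow> x \<in> (padic_ideal n :: 'p::prime_card padic set)"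
  by (auto simp: padic_ideal_def)

lemma padic_ideal_0_iff: "x \<in> padic_ideal 0 \<longleftrightarrow> (\<exists>u. x = to_fract u)"
  by (auto simp: padic_ideal_def)

lemma to_fract_in_padic_ideal [simp, intro]: "to_fract u \<in> padic_ideal 0"
  by (auto simp: padic_ideal_0_iff)

lemma padic_ideal_add [intro]:
  assumes "x \<in> padic_ideal n" "y \<in> padic_ideal n"
  shows "x + y \<in> (padic_ideal n :: 'p::prime_card padic set)"
proof -
  obtain u v where "x = of_nat CARD('p) ^ n * to_fract u" "y = of_nat CARD('p) ^ n * to_fract v"
    using assms by (metis padic_idealE)
  then have "x + y = of_nat CARD('p) ^ n * to_fract (u + v)" by (simp add: algebra_simps)
  then show ?thesis by (rule padic_idealI)
qed

lemma padic_ideal_mult: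
  assumes "x \<in> padic_ideal m" "y \<in> padic_ideal n"
  shows "x * y \<in> (padic_ideal (m + n) :: 'p::prime_card padic set)"
proof -
  obtain u v where "x = of_nat CARD('p) ^ m * to_fract u" "y = of_nat CARD('p) ^ n * to_fract v"
    using assms by (metis padic_idealE)
  then have "x * y = of_nat CARD('p) ^ (m + n) * to_fract (u * v)" by (simp add: power_add ac_simps)
  then show ?thesis by (rule padic_idealI)
qed

lemma padic_ideal_mult_left [intro]:
  "x \<in> padic_ideal 0 \<Longrightarrow> y \<in> padic_ideal n \<Longrightarrow> x * y \<in> padic_ideal n"
  using padic_ideal_mult[of x 0 y n] by simp

lemma padic_ideal_mult_right [intro]:
  "x \<in> padic_ideal n \<Longrightarrow> y \<in> padic_ideal 0 \<Longrightarrow> x * y \<in> padic_ideal n"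
  using padic_ideal_mult[of x n y 0] by simp

lemma padic_ideal_mult_1_1 [intro]:
  "x \<in> padic_ideal 1 \<Longrightarrow> y \<in> padic_ideal 1 \<Longrightarrow> x * y \<in> padic_ideal 2"
  using padic_ideal_mult[of x 1 y 1] by (simp add: numeral_2_eq_2)

lemma of_int_in_padic_ideal [simp, intro]: "of_int k \<in> padic_ideal 0"
  by (metis to_fract_of_int to_fract_in_padic_ideal)

lemma of_nat_in_padic_ideal [simp, intro]: "of_nat k \<in> padic_ideal 0"
  by (metis to_fract_of_nat to_fract_in_padic_ideal)

lemma numeral_in_padic_ideal [simp, intro]: "numeral k \<in> padic_ideal 0" "1 \<in> padic_ideal 0"
  by (metis to_fract_numeral to_fract_in_padic_ideal, metis to_fract_1 to_fract_in_padic_ideal)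

lemma zero_in_padic_ideal [simp, intro]: "0 \<in> padic_ideal n"
  by (rule padic_idealI[of _ _ 0]) simp

lemma padic_ideal_uminus [intro]: "x \<in> padic_ideal n \<Longrightarrow> - x \<in> padic_ideal n"
  using padic_ideal_mult_left[OF of_int_in_padic_ideal[of "-1"], of x n] by simp

lemma padic_ideal_diff [intro]: "x \<in> padic_ideal n \<Longrightarrow> y \<in> padic_ideal n \<Longrightarrow> x - y \<in> padic_ideal n"
  using padic_ideal_add[of x n "- y"] padic_ideal_uminus[of y n] by simp

lemma padic_ideal_sum [intro]: "(\<And>i. i \<in> A \<Longrightarrow> f i \<in> padic_ideal n) \<Longrightarrow> sum f A \<in> padic_ideal n"
  by (induction A rule: infinite_finite_induct) auto

lemma padic_ideal_power [intro]: "x \<in> padic_ideal 0 \<Longrightarrow> x ^ k \<in> padic_ideal 0"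
  by (induction k) auto

lemma padic_ideal_antimono:
  assumes "x \<in> padic_ideal n" "m \<le> n"
  shows "x \<in> (padic_ideal m :: 'p::prime_card padic set)"
proof -
  obtain u where "x = of_nat CARD('p) ^ n * to_fract u" using assms by (metis padic_idealE)
  then have "x = of_nat CARD('p) ^ m * to_fract (of_nat CARD('p) ^ (n - m) * u)"
    using assms(2) by (simp add: power_add[symmetric] mult.assoc[symmetric])
  then show ?thesis by (rule padic_idealI)
qed

lemma padic_ideal_1_imp_0 [intro]: "x \<in> padic_ideal 1 \<Longrightarrow> x \<in> padic_ideal 0"
  by (rule padic_ideal_antimono) auto

lemma padic_ideal_2_imp_1 [intro]: "x \<in> padic_ideal 2 \<Longrightarrow> x \<in> padic_ideal 1"
  by (rule padic_ideal_antimono) auto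

text \<open>The simplifier rewrites \<open>1 :: nat\<close> to \<open>Suc 0\<close>, so automation needs these rules in that form.\<close>

declare padic_ideal_mult_1_1 [simplified, intro] padic_ideal_1_imp_0 [simplified, intro]
  padic_ideal_2_imp_1 [simplified, intro]

lemma prime_power_in_padic_ideal: "of_nat (CARD('p) ^ n) \<in> (padic_ideal n :: 'p::prime_card padic set)"
  by (rule padic_idealI[of _ _ 1]) simp

text \<open>Integrality of \<open>y\<close> is enough, since \<open>x = y + (x - y)\<close> is then
  integral whenever the difference lies in the ideal.\<close>

lemma padic_cong_iff_diff_in_padic_ideal:
  fixes x y :: "'p::prime_card padic"
  assumes "y \<in> padic_ideal 0"
  shows "padic_cong x y (CARD('p) ^ n) \<longleftrightarrow> x - y \<in> padic_ideal n"
proof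
  assume "padic_cong x y (CARD('p) ^ n)"
  then obtain u v w :: "'p padic_int"
    where "x = to_fract u" "y = to_fract v" "u - v = of_nat (CARD('p) ^ n) * w"
    unfolding padic_cong_def dvd_def by auto
  then have "x - y = of_nat CARD('p) ^ n * to_fract w"
    by (metis of_nat_power to_fract_diff to_fract_mult to_fract_of_nat)
  then show "x - y \<in> padic_ideal n" by (rule padic_idealI)
next
  assume "x - y \<in> padic_ideal n"
  then obtain w where w: "x - y = of_nat CARD('p) ^ n * to_fract w" by (rule padic_idealE)
  from assms obtain v where v: "y = to_fract v" by (auto simp: padic_ideal_0_iff)
  have "x = to_fract (v + of_nat CARD('p) ^ n * w)" using w v by (simp add: algebra_simps)
  then show "padic_cong x y (CARD('p) ^ n)"
    unfolding padic_cong_def v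
    by (intro exI[of _ "v + of_nat CARD('p) ^ n * w"] exI[of _ v]) simp
qed

lemma padic_int_dvd_iff: "of_nat CARD('p) dvd (u :: 'p::prime_card padic_int) \<longleftrightarrow> Rep_padic_int u 1 = 0"
proof
  assume "of_nat CARD('p) dvd u"
  then obtain v where "u = of_nat CARD('p) * v" by (auto simp: dvd_def)
  then show "Rep_padic_int u 1 = 0"
    by (simp add: times_padic_int.rep_eq Rep_padic_int_of_nat)
next
  let ?P = "int CARD('p)"
  have P: "?P > 0" using prime_int_card prime_gt_0_int by blast
  assume 0: "Rep_padic_int u 1 = 0"
  \<comment> \<open>Dividing by \<open>p\<close> costs one digit: the quotient modulo
    \<open>p^n\<close> is read off from \<open>u\<close> modulo \<open>p^(n+1)\<close>.\<close>
  define f where "f n = Rep_padic_int u (Suc n) div ?P" for n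
  have f: "Rep_padic_int u (Suc n) = ?P * f n" for n
  proof -
    have "Rep_padic_int u (Suc n) mod ?P ^ 1 = 0" using Rep_padic_int_mod[of 1 "Suc n" u] 0 by simp
    then show ?thesis by (simp add: f_def dvd_eq_mod_eq_0[symmetric])
  qed
  have "f n = f (Suc n) mod ?P ^ n" for n
  proof -
    have "?P * f n = (?P * f (Suc n)) mod (?P * ?P ^ n)"
      using Rep_padic_int_Suc[of u "Suc n"] by (simp add: f)
    also have "\<dots> = ?P * (f (Suc n) mod ?P ^ n)" by (rule mult_mod_right[symmetric])
    finally show ?thesis using P by simp
  qed
  then have rep: "Rep_padic_int (Abs_padic_int f :: 'p padic_int) = f"
    by (intro Abs_padic_int_inverse CollectI allI)
  have "u = of_nat CARD('p) * Abs_padic_int f"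
  proof (rule padic_int_eqI)
    fix n
    show "Rep_padic_int u n = Rep_padic_int (of_nat CARD('p) * Abs_padic_int f :: 'p padic_int) n"
      unfolding times_padic_int.rep_eq Rep_padic_int_of_nat rep mod_mult_left_eq f[symmetric]
      by (rule Rep_padic_int_Suc[symmetric])
  qed
  then show "of_nat CARD('p) dvd u" by simp
qed

text \<open>Inverts \<open>u\<close> modulo every \<open>p^n\<close> separately; the inverses are
  coherent because an inverse modulo \<open>p^n\<close> is unique.\<close>

lemma padic_int_is_unit:
  fixes u :: "'p::prime_card padic_int"
  assumes "Rep_padic_int u 1 \<noteq> 0"
  shows "u dvd 1"
proof -
  let ?P = "int CARD('p)"
  have P: "?P > 1" using prime_int_card prime_gt_1_int by blast
  have cop: "coprime (Rep_padic_int u n) (?P ^ n)" for n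
  proof (cases n)
    case (Suc k)
    have "Rep_padic_int u n mod ?P ^ 1 \<noteq> 0"
      using Rep_padic_int_mod[of 1 n u] Suc assms by simp
    then have "\<not> ?P dvd Rep_padic_int u n" by (simp add: dvd_eq_mod_eq_0)
    then have "coprime ?P (Rep_padic_int u n)" using prime_int_card prime_imp_coprime by blast
    then show ?thesis by (simp add: coprime_commute)
  qed simp
  define f where "f n = modular_inverse (?P ^ n) (Rep_padic_int u n)" for n
  have inv: "[f n * Rep_padic_int u n = 1] (mod ?P ^ n)" for n
    unfolding f_def by (rule cong_modular_inverse2) (rule cop)
  have rng: "f n mod ?P ^ n = f n" for n
    unfolding f_def using P by (intro mod_pos_pos_trivial modular_inverse_int_nonneg modular_inverse_int_less) simp_all
  have "f n = f (Suc n) mod ?P ^ n" for n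
  proof -
    have "[f (Suc n) * Rep_padic_int u (Suc n) = 1] (mod ?P ^ n)"
      using inv[of "Suc n"] by (rule cong_dvd_modulus) simp
    moreover have "[Rep_padic_int u (Suc n) = Rep_padic_int u n] (mod ?P ^ n)"
      using Rep_padic_int_Suc[of u n] Rep_padic_int_mod[of n n u] by (simp add: cong_def)
    ultimately have "[f (Suc n) * Rep_padic_int u n = 1] (mod ?P ^ n)"
      by (metis cong_scalar_left cong_sym cong_trans)
    then have "[f (Suc n) * Rep_padic_int u n = f n * Rep_padic_int u n] (mod ?P ^ n)"
      by (rule cong_trans) (rule cong_sym, rule inv)
    then have "[f (Suc n) = f n] (mod ?P ^ n)"
      using cop[of n] by (simp add: cong_mult_rcancel)
    then show ?thesis using rng[of n] by (simp add: cong_def)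
  qed
  then have rep: "Rep_padic_int (Abs_padic_int f :: 'p padic_int) = f"
    by (intro Abs_padic_int_inverse CollectI allI)
  have "1 = u * Abs_padic_int f"
    by (rule padic_int_eqI)
      (unfold times_padic_int.rep_eq one_padic_int.rep_eq rep, subst mult.commute,
        rule inv[unfolded cong_def, symmetric])
  then show ?thesis by (rule dvdI)
qed

lemma inverse_in_padic_ideal:
  fixes u :: "'p::prime_card padic_int"
  assumes "\<not> of_nat CARD('p) dvd u"
  shows "inverse (to_fract u) \<in> padic_ideal 0"
proof -
  obtain v where "1 = u * v" using padic_int_is_unit assms by (metis padic_int_dvd_iff dvdE)
  then have "to_fract u * to_fract v = 1" by (metis to_fract_1 to_fract_mult)
  then have "inverse (to_fract u) = to_fract v" by (rule inverse_unique)
  then show ?thesis by simp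
qed

lemma of_nat_card_dvd_of_nat_iff:
  "of_nat CARD('p) dvd (of_nat k :: 'p::prime_card padic_int) \<longleftrightarrow> CARD('p) dvd k"
proof -
  have "int k mod int CARD('p) = 0 \<longleftrightarrow> CARD('p) dvd k"
    by (metis dvd_eq_mod_eq_0 of_nat_dvd_iff)
  then show ?thesis by (simp add: padic_int_dvd_iff Rep_padic_int_of_nat)
qed

lemma inverse_of_nat_in_padic_ideal:
  assumes "\<not> CARD('p) dvd k"
  shows "inverse (of_nat k) \<in> (padic_ideal 0 :: 'p::prime_card padic set)"
  using inverse_in_padic_ideal[where 'p='p, of "of_nat k"] assms
  by (simp add: of_nat_card_dvd_of_nat_iff)

text \<open>The multiplicity \<open>s\<close> of \<open>p\<close> in \<open>l\<close> is below
  \<open>a\<close>, so the quotient is \<open>p^(a-s)\<close> times a unit. This is the source of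
  the factor \<open>p\<close> in every \<open>q / j\<close>.\<close>

lemma prime_power_divide_in_padic_ideal:
  assumes "\<not> CARD('p) ^ a dvd l"
  shows "of_nat (CARD('p) ^ a) / of_nat l \<in> (padic_ideal 1 :: 'p::prime_card padic set)"
proof -
  let ?p = "CARD('p)"
  have p: "prime ?p" by (rule prime_card)
  then have "?p > 1" using prime_gt_1_nat by blast
  have "l \<noteq> 0" using assms by (intro notI) simp
  then obtain l' where l': "l = ?p ^ multiplicity ?p l * l'" "\<not> ?p dvd l'"
    using multiplicity_decompose'[of l ?p] p \<open>?p > 1\<close> by (metis not_prime_unit)
  define s where "s = multiplicity ?p l"
  have "s < a"
  proof (rule ccontr)
    assume "\<not> s < a"
    then have "?p ^ a dvd ?p ^ s" by (simp add: le_imp_power_dvd)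
    then have "?p ^ a dvd l" unfolding s_def by (subst l'(1)) (rule dvd_mult2)
    with assms show False by simp
  qed
  then have a: "?p ^ a = ?p ^ s * ?p ^ (a - s)" by (simp add: power_add[symmetric])
  have "(of_nat (?p ^ s) :: 'p padic) \<noteq> 0" using \<open>?p > 1\<close> by simp
  then have "of_nat (?p ^ a) / of_nat l = (of_nat (?p ^ (a - s)) * inverse (of_nat l') :: 'p padic)"
    unfolding a l'(1)[folded s_def] by (simp add: divide_inverse)
  also have "\<dots> \<in> padic_ideal (a - s)"
    by (intro padic_ideal_mult_right prime_power_in_padic_ideal inverse_of_nat_in_padic_ideal l')
  finally show ?thesis by (rule padic_ideal_antimono) (use \<open>s < a\<close> in simp)
qed

subsection \<open>Congruences modulo a prime power\<close>

text \<open>Unlike in \<open>padic_cong\<close>, integrality is not built in, so the relation is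
  reflexive on the whole field and can be chained freely; integrality is demanded only for
  products.\<close>

definition padic_eq :: "nat \<Rightarrow> 'p::prime_card padic \<Rightarrow> 'p padic \<Rightarrow> bool" where
  "padic_eq n x y \<longleftrightarrow> x - y \<in> padic_ideal n"

lemma padic_eq_refl [simp]: "padic_eq n x x"
  by (simp add: padic_eq_def)

lemma padic_eq_sym: "padic_eq n x y \<Longrightarrow> padic_eq n y x"
  using padic_ideal_uminus[of "x - y" n] by (simp add: padic_eq_def)

lemma padic_eq_trans [trans]: "padic_eq n x y \<Longrightarrow> padic_eq n y z \<Longrightarrow> padic_eq n x z"
  using padic_ideal_add[of "x - y" n "y - z"] by (simp add: padic_eq_def)

lemma padic_eq_add: "padic_eq n x y \<Longrightarrow> padic_eq n x' y' \<Longrightarrow> padic_eq n (x + x') (y + y')"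
  using padic_ideal_add[of "x - y" n "x' - y'"] by (simp add: padic_eq_def algebra_simps)

lemma padic_eq_uminus: "padic_eq n x y \<Longrightarrow> padic_eq n (- x) (- y)"
  using padic_ideal_uminus[of "x - y" n] by (simp add: padic_eq_def)

lemma padic_eq_diff: "padic_eq n x y \<Longrightarrow> padic_eq n x' y' \<Longrightarrow> padic_eq n (x - x') (y - y')"
  using padic_eq_add[of n x y "- x'" "- y'"] padic_eq_uminus[of n x' y'] by simp

lemma padic_eq_sum: "(\<And>i. i \<in> A \<Longrightarrow> padic_eq n (f i) (g i)) \<Longrightarrow> padic_eq n (sum f A) (sum g A)"
  by (induction A rule: infinite_finite_induct) (auto intro: padic_eq_add)

lemma padic_eq_mult_right: "padic_eq n x y \<Longrightarrow> c \<in> padic_ideal 0 \<Longrightarrow> padic_eq n (x * c) (y * c)"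
  using padic_ideal_mult_right[of "x - y" n c] by (simp add: padic_eq_def algebra_simps)

lemma padic_eq_mult_left: "padic_eq n x y \<Longrightarrow> c \<in> padic_ideal 0 \<Longrightarrow> padic_eq n (c * x) (c * y)"
  using padic_eq_mult_right[of n x y c] by (simp add: mult.commute)

text \<open>Next to a factor divisible by \<open>p\<close>, the cofactor matters only modulo
  \<open>p\<close>. This is what makes the weights \<open>q / j\<close> manageable.\<close>

lemma padic_eq_1_mult_right: "padic_eq 1 x y \<Longrightarrow> c \<in> padic_ideal 1 \<Longrightarrow> padic_eq 2 (x * c) (y * c)"
  using padic_ideal_mult_1_1[of "x - y" c] by (simp add: padic_eq_def algebra_simps)

lemma padic_eq_mult:
  assumes "padic_eq n x y" "padic_eq n x' y'" "x \<in> padic_ideal 0" "y' \<in> padic_ideal 0"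
  shows "padic_eq n (x * x') (y * y')"
proof -
  have "x * x' - y * y' = x * (x' - y') + (x - y) * y'" by (simp add: algebra_simps)
  then show ?thesis using assms by (auto simp: padic_eq_def)
qed

lemma padic_eq_in_padic_ideal_0: "padic_eq n x y \<Longrightarrow> y \<in> padic_ideal 0 \<Longrightarrow> x \<in> padic_ideal 0"
  using padic_ideal_add[OF padic_ideal_antimono[of "x - y" n 0], of y] by (simp add: padic_eq_def)

lemma padic_eq_power:
  assumes "padic_eq n x y" "y \<in> padic_ideal 0"
  shows "padic_eq n (x ^ k) (y ^ k)"
proof (induction k)
  case (Suc k)
  then show ?case
    using assms padic_eq_in_padic_ideal_0[OF assms] by (auto intro!: padic_eq_mult)
qed simp

lemma padic_eq_antimono: "padic_eq n x y \<Longrightarrow> m \<le> n \<Longrightarrow> padic_eq m x y"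
  unfolding padic_eq_def by (rule padic_ideal_antimono)

lemma one_plus_power_padic_eq:
  assumes "x \<in> padic_ideal 1"
  shows "padic_eq 2 ((1 + x) ^ n) (1 + of_nat n * x)"
proof (induction n)
  case (Suc n)
  have "padic_eq 2 ((1 + x) * (1 + x) ^ n) ((1 + x) * (1 + of_nat n * x))"
    using Suc assms by (intro padic_eq_mult) auto
  moreover have "(1 + x) * (1 + of_nat n * x) - (1 + of_nat (Suc n) * x) = of_nat n * (x * x)"
    by (simp add: algebra_simps)
  then have "padic_eq 2 ((1 + x) * (1 + of_nat n * x)) (1 + of_nat (Suc n) * x)"
    unfolding padic_eq_def using assms by (simp only:) auto
  ultimately show ?case by (auto intro: padic_eq_trans)
qed simp

section \<open>Harmonic sums scaled by \<open>q\<close>, and binomial coefficients modulo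
  \<open>p\<close> and \<open>p^2\<close>\<close>

abbreviation scaled_harmonic :: "nat \<Rightarrow> nat \<Rightarrow> 'a::field_char_0" where
  "scaled_harmonic q k \<equiv> \<Sum>j=1..k. of_nat q / of_nat j"

text \<open>Centred at \<open>j = m\<close> because there \<open>2 * j + 1 = q\<close>, the only
  denominator \<open>2 * j + 1\<close> with \<open>j < q\<close> that is a multiple of
  \<open>q\<close>.\<close>

lemma sum_symmetric_split:
  fixes g :: "nat \<Rightarrow> 'a::ab_group_add"
  shows "(\<Sum>j<2 * m + 1. g j) = g m + (\<Sum>i=1..m. g (m - i) + g (m + i))"
proof -
  have "(\<Sum>i=1..m. g (m - i)) = (\<Sum>j<m. g j)"
    by (rule sum.reindex_bij_witness[of _ "\<lambda>j. m - j" "\<lambda>i. m - i"]) auto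
  moreover have "(\<Sum>i=1..m. g (m + i)) = (\<Sum>j\<in>{m<..<2 * m + 1}. g j)"
    by (rule sum.reindex_bij_witness[of _ "\<lambda>j. j - m" "\<lambda>i. m + i"]) auto
  moreover have "(\<Sum>j<2 * m + 1. g j) = g m + ((\<Sum>j<m. g j) + (\<Sum>j\<in>{m<..<2 * m + 1}. g j))"
  proof -
    have *: "{..<2 * m + 1} = insert m ({..<m} \<union> {m<..<2 * m + 1})" by auto
    have "(\<Sum>j\<in>{..<m} \<union> {m<..<2 * m + 1}. g j) = (\<Sum>j<m. g j) + (\<Sum>j\<in>{m<..<2 * m + 1}. g j)"
      by (rule sum.union_disjoint) auto
    then show ?thesis unfolding * by (subst sum.insert) auto
  qed
  ultimately show ?thesis by (simp add: sum.distrib)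
qed

lemma odd_prime_card_not_dvd_2: "odd CARD('p::prime_card) \<Longrightarrow> \<not> CARD('p) dvd 2"
  using prime_card[where 'a='p] by (metis dvd_refl primes_dvd_imp_eq two_is_prime_nat)

context
  fixes a q m :: nat
  assumes odd_p: "odd CARD('p::prime_card)" and q: "q = CARD('p) ^ a" and m: "q = 2 * m + 1"
begin

lemma half_in_padic_ideal: "x \<in> padic_ideal n \<Longrightarrow> x / 2 \<in> (padic_ideal n :: 'p padic set)"
proof -
  assume x: "x \<in> (padic_ideal n :: 'p padic set)"
  have "inverse (of_nat 2) \<in> (padic_ideal 0 :: 'p padic set)" 
    by (rule inverse_of_nat_in_padic_ideal[OF odd_prime_card_not_dvd_2[OF odd_p]])
  with x have "x * inverse (of_nat 2) \<in> padic_ideal n" by (rule padic_ideal_mult_right)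
  then show ?thesis by (simp only: divide_inverse of_nat_numeral)
qed

lemma q_divide_in_padic_ideal: "\<not> q dvd l \<Longrightarrow> of_nat q / of_nat l \<in> (padic_ideal 1 :: 'p padic set)"
  unfolding q by (rule prime_power_divide_in_padic_ideal)

lemma q_divide_in_padic_ideal': "0 < l \<Longrightarrow> l < q \<Longrightarrow> of_nat q / of_nat l \<in> (padic_ideal 1 :: 'p padic set)"
  by (rule q_divide_in_padic_ideal) (auto dest: dvd_imp_le)

lemma scaled_harmonic_in_padic_ideal: "k < q \<Longrightarrow> scaled_harmonic q k \<in> (padic_ideal 1 :: 'p padic set)"
  by (intro padic_ideal_sum q_divide_in_padic_ideal') auto

text \<open>The sign turns each factor \<open>(h * q - j) / j\<close> into
  \<open>1 - h * q / j\<close>. On multiplying out, the terms of second order contain two weights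
  \<open>q / j\<close> and vanish modulo \<open>p^2\<close>.\<close>

lemma gbinomial_padic_eq:
  assumes h: "(h :: 'p padic) \<in> padic_ideal 0" and "k < q"
  shows "padic_eq 2 ((- 1) ^ k * ((h * of_nat q - 1) gchoose k)) (1 - h * scaled_harmonic q k)"
  using \<open>k < q\<close>
proof (induction k)
  case (Suc k)
  let ?b = "\<lambda>k. (h * of_nat q - 1) gchoose k"
  let ?w = "of_nat q / of_nat (Suc k) :: 'p padic"
  have w: "?w \<in> padic_ideal 1" using Suc.prems by (intro q_divide_in_padic_ideal') auto
  have s: "scaled_harmonic q k \<in> (padic_ideal 1 :: 'p padic set)"
    using Suc.prems by (intro scaled_harmonic_in_padic_ideal) auto
  have "(of_nat (Suc k) :: 'p padic) \<noteq> 0" by (simp only: of_nat_eq_0_iff)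
  then have "?b (Suc k) = (h * of_nat q - of_nat (Suc k)) / of_nat (Suc k) * ?b k"
    using Suc_times_gbinomial_Suc[of k "h * of_nat q - 1"] by (simp add: field_simps)
  also have "(h * of_nat q - of_nat (Suc k)) / of_nat (Suc k) = h * ?w - 1"
    using \<open>of_nat (Suc k) \<noteq> 0\<close> by (simp add: diff_divide_distrib del: of_nat_Suc)
  finally have step: "?b (Suc k) = (h * ?w - 1) * ?b k" .
  have "(- 1 * s) * ((c - 1) * b) = (1 - c) * (s * b)" for s c b :: "'p padic"
    by (simp add: algebra_simps)
  then have "(- 1) ^ Suc k * ?b (Suc k) = (1 - h * ?w) * ((- 1) ^ k * ?b k)"
    unfolding step power_Suc .
  also have "padic_eq 2 \<dots> ((1 - h * ?w) * (1 - h * scaled_harmonic q k))"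
    using Suc by (intro padic_eq_mult_left padic_ideal_diff padic_ideal_mult_left[OF h]
        padic_ideal_1_imp_0[OF w]) auto
  also have "padic_eq 2 \<dots> (1 - h * scaled_harmonic q (Suc k))"
  proof -
    have "(1 - h * ?w) * (1 - h * scaled_harmonic q k) - (1 - h * scaled_harmonic q (Suc k))
        = h * (h * (?w * scaled_harmonic q k))"
      by (simp add: algebra_simps)
    also have "\<dots> \<in> padic_ideal 2" by (intro padic_ideal_mult_left[OF h] padic_ideal_mult_1_1 w s)
    finally show ?thesis by (simp only: padic_eq_def)
  qed
  finally show ?case .
qed simp

lemma gbinomial_in_padic_ideal:
  assumes h: "(h :: 'p padic) \<in> padic_ideal 0" and "k < q"
  shows "((h * of_nat q - 1) gchoose k) \<in> padic_ideal 0"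
proof -
  have "(- 1) ^ k * ((h * of_nat q - 1) gchoose k) \<in> padic_ideal 0"
    using gbinomial_padic_eq[OF assms] scaled_harmonic_in_padic_ideal[of k] assms
    by (elim padic_eq_in_padic_ideal_0) auto
  then show ?thesis
    using padic_ideal_uminus[of "(- 1) ^ k * ((h * of_nat q - 1) gchoose k)" 0]
    by (cases "even k") simp_all
qed

lemma binomial_pred_padic_eq:
  assumes "k < q"
  shows "padic_eq 2 ((- 1) ^ k * of_nat (q - 1 choose k)) (1 - scaled_harmonic q k :: 'p padic)"
  using gbinomial_padic_eq[of 1 k] assms by (simp add: binomial_gbinomial of_nat_diff)

text \<open>Vandermonde's convolution for \<open>-1/2 = m - q/2\<close>: every term except
  \<open>m choose k\<close> contains a binomial coefficient of \<open>-q/2\<close> with positive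
  lower index, and these are divisible by \<open>p\<close>.\<close>

lemma central_binomial_padic_eq:
  assumes "k < q"
  shows "padic_eq 1 (of_nat (2 * k choose k)) (of_nat (m choose k) * (- 4) ^ k :: 'p padic)"
proof -
  let ?b = "- (of_nat q / 2) :: 'p padic"
  have half: "(1 / 2 :: 'p padic) \<in> padic_ideal 0" by (intro half_in_padic_ideal) simp
  have b: "(?b gchoose i) \<in> padic_ideal 1" if "0 < i" "i < q" for i
  proof -
    \<comment> \<open>Absorption extracts the weight \<open>q / i\<close>; the cofactor is the
      integral binomial coefficient treated above, with \<open>h = -1/2\<close>.\<close>
    have "(?b gchoose i) = - (1 / 2) * (of_nat q / of_nat i * ((- (1 / 2) * of_nat q - 1) gchoose (i - 1)))"
      using that by (subst gbinomial_absorption') (simp_all add: field_simps)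
    also have "\<dots> \<in> padic_ideal 1"
      using that half
      by (intro padic_ideal_mult_left[OF padic_ideal_uminus] padic_ideal_mult_right
          gbinomial_in_padic_ideal q_divide_in_padic_ideal') auto
    finally show ?thesis .
  qed
  have "- 1 / 2 = (of_nat m + ?b)" by (simp add: m field_simps)
  then have "((- 1 / 2 :: 'p padic) gchoose k) = (\<Sum>i=0..k. (of_nat m gchoose i) * (?b gchoose (k - i)))"
    by (simp only: gbinomial_Vandermonde)
  also have "\<dots> = (\<Sum>i<k. of_nat (m choose i) * (?b gchoose (k - i))) + of_nat (m choose k)"
    by (simp add: atLeast0AtMost lessThan_Suc_atMost[symmetric] binomial_gbinomial)
  finally have "((- 1 / 2 :: 'p padic) gchoose k) - of_nat (m choose k)
      = (\<Sum>i<k. of_nat (m choose i) * (?b gchoose (k - i)))" by simp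
  also have "\<dots> \<in> padic_ideal 1"
    using assms by (intro padic_ideal_sum padic_ideal_mult_left b) auto
  finally have "padic_eq 1 ((- 1 / 2 :: 'p padic) gchoose k) (of_nat (m choose k))"
    by (simp add: padic_eq_def)
  moreover have "(- 4) ^ k \<in> (padic_ideal 0 :: 'p padic set)" by auto
  ultimately have "padic_eq 1 (((- 1 / 2 :: 'p padic) gchoose k) * (- 4) ^ k) (of_nat (m choose k) * (- 4) ^ k)"
    by (rule padic_eq_mult_right)
  then show ?thesis by (simp only: gbinomial_minus_half)
qed

text \<open>The sum of the two weights equals their product, and each is divisible by
  \<open>p\<close>.\<close>

lemma q_divide_reflect:
  assumes "0 < i" "i < q"
  shows "padic_eq 2 (of_nat q / of_nat (q - i)) (- (of_nat q / of_nat i) :: 'p padic)"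
proof -
  have nz: "(of_nat i :: 'p padic) \<noteq> 0" "(of_nat (q - i) :: 'p padic) \<noteq> 0"
    using assms by simp_all
  have "of_nat (q - i) = (of_nat q - of_nat i :: 'p padic)" using assms by (simp add: of_nat_diff)
  then have "of_nat q / of_nat (q - i) - (- (of_nat q / of_nat i) :: 'p padic)
      = of_nat q / of_nat i * (of_nat q / of_nat (q - i))"
    using nz by (simp add: field_simps)
  also have "\<dots> \<in> padic_ideal 2"
    using assms by (intro padic_ideal_mult_1_1 q_divide_in_padic_ideal') auto
  finally show ?thesis by (simp add: padic_eq_def)
qed

text \<open>Reflecting \<open>i\<close> to \<open>q - i\<close> sends the sum to its own negative
  modulo \<open>p^2\<close>, and 2 is invertible.\<close>

lemma scaled_harmonic_pred: "scaled_harmonic q (q - 1) \<in> (padic_ideal 2 :: 'p padic set)"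
proof -
  have "scaled_harmonic q (q - 1) = (\<Sum>i=1..q-1. of_nat q / of_nat (q - i) :: 'p padic)"
    by (rule sum.reindex_bij_witness[of _ "\<lambda>i. q - i" "\<lambda>i. q - i"]) auto
  also have "padic_eq 2 \<dots> (\<Sum>i=1..q-1. - (of_nat q / of_nat i))"
    by (intro padic_eq_sum q_divide_reflect) auto
  finally have "scaled_harmonic q (q - 1) + scaled_harmonic q (q - 1) \<in> (padic_ideal 2 :: 'p padic set)"
    by (simp add: padic_eq_def sum_negf)
  from half_in_padic_ideal[OF this] show ?thesis by simp
qed

text \<open>Half of the coefficient is \<open>2 * q - 1 choose (q - 1)\<close>, the case
  \<open>h = 2\<close> of the congruence above, whose harmonic term vanishes modulo
  \<open>p^2\<close>.\<close>

lemma central_binomial_q: "padic_eq 2 (of_nat (2 * q choose q)) (2 :: 'p padic)"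
proof -
  have q1: "q > 0" using m by simp
  have "2 * q choose q = 2 * (2 * q - 1 choose (q - 1))"
    using q1 binomial_absorption[of "q - 1" "2 * q"] by simp
  moreover have "padic_eq 2 ((- 1) ^ (q - 1) * ((2 * of_nat q - 1) gchoose (q - 1)))
      (1 - 2 * scaled_harmonic q (q - 1) :: 'p padic)"
    using q1 by (intro gbinomial_padic_eq) auto
  moreover have "2 * of_nat q - 1 = (of_nat (2 * q - 1) :: 'p padic)" using q1 by (simp add: of_nat_diff)
  moreover have "(- 1) ^ (q - 1) = (1 :: 'p padic)" by (simp add: m)
  ultimately have "padic_eq 2 (of_nat (2 * q - 1 choose (q - 1))) (1 - 2 * scaled_harmonic q (q - 1) :: 'p padic)"
    by (simp add: binomial_gbinomial)
  also have "padic_eq 2 \<dots> 1" using scaled_harmonic_pred by (auto simp: padic_eq_def)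
  finally have "padic_eq 2 (2 * of_nat (2 * q - 1 choose (q - 1))) (2 * 1 :: 'p padic)"
    by (rule padic_eq_mult_left) simp
  then show ?thesis by (simp add: \<open>2 * q choose q = _\<close>)
qed

text \<open>Absorption gives \<open>q choose i = (q / i) * (q - 1 choose (i - 1))\<close>, and the
  last factor is a sign modulo \<open>p\<close>. So the sum is, up to sign, the expansion of
  \<open>(1 - z) ^ q\<close> without its two end terms.\<close>

lemma sum_q_divide_power:
  assumes z: "(z :: 'p padic) \<in> padic_ideal 0"
  shows "padic_eq 2 (\<Sum>i=1..q-1. of_nat q / of_nat i * z ^ i) (1 - z ^ q - (1 - z) ^ q)"
proof -
  have q1: "q > 0" "odd q" using m by simp_all
  have coeff: "padic_eq 2 (of_nat q / of_nat i * z ^ i) (- (of_nat (q choose i) * (- z) ^ i))"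
    if "i \<in> {1..q-1}" for i
  proof -
    from that obtain j where j: "i = Suc j" "j < q" "Suc j < q" by (cases i) auto
    have "(of_nat i * of_nat (q choose i) :: 'p padic) = of_nat q * of_nat (q - 1 choose j)"
      using binomial_absorption[of j q] j by (metis of_nat_mult)
    then have "- (of_nat (q choose i) * (- z) ^ i)
        = of_nat q / of_nat i * z ^ i * ((- 1) ^ j * of_nat (q - 1 choose j))"
      using j by (simp add: field_simps power_minus[of z] del: of_nat_Suc)
    moreover have "padic_eq 1 ((- 1) ^ j * of_nat (q - 1 choose j)) (1 - scaled_harmonic q j :: 'p padic)"
      by (rule padic_eq_antimono[OF binomial_pred_padic_eq]) (use j in auto)
    then have "padic_eq 1 ((- 1) ^ j * of_nat (q - 1 choose j)) (1 :: 'p padic)"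
      by (rule padic_eq_trans) (use scaled_harmonic_in_padic_ideal[of j] j in \<open>auto simp: padic_eq_def\<close>)
    moreover have "of_nat q / of_nat i * z ^ i \<in> padic_ideal 1"
      using that z by (intro padic_ideal_mult_right q_divide_in_padic_ideal') auto
    ultimately show ?thesis
      using padic_eq_1_mult_right[of "(- 1) ^ j * of_nat (q - 1 choose j)" 1 "of_nat q / of_nat i * z ^ i"]
      by (simp add: padic_eq_sym mult.commute)
  qed
  have "(1 - z) ^ q = (\<Sum>i\<le>q. of_nat (q choose i) * (- z) ^ i)"
    using binomial_ring[of "- z" 1 q] by (simp add: mult_ac)
  also have "{..q} = insert 0 (insert q {1..q-1})" using q1 by auto
  also have "(\<Sum>i\<in>insert 0 (insert q {1..q-1}). of_nat (q choose i) * (- z) ^ i)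
      = 1 - z ^ q + (\<Sum>i=1..q-1. of_nat (q choose i) * (- z) ^ i)"
    using q1 by (subst sum.insert, simp, simp, subst sum.insert) (auto simp: power_minus[of z])
  finally have *: "1 - z ^ q - (1 - z) ^ q = (\<Sum>i=1..q-1. - (of_nat (q choose i) * (- z) ^ i))"
    by (simp add: sum_negf)
  show ?thesis unfolding * by (rule padic_eq_sum[OF coeff])
qed

text \<open>Take \<open>z = -1\<close> above and add the full harmonic sum, which is 0 modulo
  \<open>p^2\<close>: odd indices cancel, even ones double, and
  \<open>2 * q / (2 * i) = q / i\<close>.\<close>

lemma scaled_harmonic_half: "padic_eq 2 (scaled_harmonic q m) (2 - 2 ^ q :: 'p padic)"
proof -
  let ?w = "\<lambda>i. of_nat q / of_nat i :: 'p padic"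
  have "(\<Sum>i=1..q-1. ?w i * (- 1) ^ i) + scaled_harmonic q (q - 1)
      = (\<Sum>i=1..q-1. if even i then 2 * ?w i else 0)"
    by (simp add: sum.distrib[symmetric]) (auto intro!: sum.cong)
  also have "\<dots> = (\<Sum>i\<in>{i\<in>{1..q-1}. even i}. 2 * ?w i)"
    by (simp add: sum.inter_filter[symmetric])
  also have "\<dots> = scaled_harmonic q m"
    by (rule sum.reindex_bij_witness[of _ "\<lambda>i. 2 * i" "\<lambda>i. i div 2"]) (auto simp: m field_simps elim!: evenE)
  finally have *: "scaled_harmonic q m = (\<Sum>i=1..q-1. ?w i * (- 1) ^ i) + scaled_harmonic q (q - 1)" ..
  have "padic_eq 2 (\<Sum>i=1..q-1. ?w i * (- 1) ^ i) (1 - (- 1) ^ q - (1 - - 1) ^ q)"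
    by (rule sum_q_divide_power) auto
  moreover have "padic_eq 2 (scaled_harmonic q (q - 1)) (0 :: 'p padic)"
    using scaled_harmonic_pred by (simp add: padic_eq_def)
  ultimately have "padic_eq 2 (scaled_harmonic q m) ((1 - (- 1) ^ q - (1 - - 1) ^ q) + 0 :: 'p padic)"
    unfolding * by (rule padic_eq_add)
  then show ?thesis by (simp add: m)
qed

section \<open>The sums \<open>A\<close> and \<open>B\<close> modulo \<open>p^2\<close>\<close>

text \<open>The exact identity is used with \<open>n = q\<close>. The index \<open>j = m\<close> has
  weight \<open>q / (2 * m + 1) = 1\<close> and needs its binomial coefficient modulo
  \<open>p^2\<close>; all other weights are divisible by \<open>p\<close>, so there a sign
  suffices.\<close>

lemma sum_central_binomial_padic_eq:
  assumes x: "(x :: 'p padic) \<in> padic_ideal 0" and d: "d = 1 - 4 * x"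
  shows "padic_eq 2 (4 ^ (q - 1) * (\<Sum>k<q. of_nat (2 * k choose k) * x ^ k))
    ((1 - scaled_harmonic q m) * d ^ m
      - (\<Sum>i=1..m. of_nat q / of_nat i * (d ^ (m - i) - d ^ (m + i))) / 2)"
proof -
  have d0: "d \<in> padic_ideal 0" using x d by auto
  let ?w = "\<lambda>i. of_nat q / of_nat i :: 'p padic"
  let ?c = "\<lambda>j. (- 1) ^ j * of_nat (q - 1 choose j) :: 'p padic"
  define g where "g j = ?c j * (d ^ j * ?w (2 * j + 1))" for j
  have c0: "?c j \<in> padic_ideal 0" for j by (intro padic_ideal_mult_left) auto
  have c1: "padic_eq 1 (?c j) 1" if "j < q" for j
  proof -
    have "padic_eq 1 (?c j) (1 - scaled_harmonic q j)"
      by (rule padic_eq_antimono[OF binomial_pred_padic_eq]) (use that in auto)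
    also have "padic_eq 1 \<dots> 1"
      using scaled_harmonic_in_padic_ideal[of j] that by (auto simp: padic_eq_def)
    finally show ?thesis .
  qed
  have side: "padic_eq 2 (g j) (d ^ j * y)"
    if "j < q" "\<not> q dvd 2 * j + 1" "padic_eq 2 (?w (2 * j + 1)) y" for j y
  proof -
    have "d ^ j * ?w (2 * j + 1) \<in> padic_ideal 1"
      using d0 by (intro padic_ideal_mult_left padic_ideal_power q_divide_in_padic_ideal that)
    then have "padic_eq 2 (g j) (1 * (d ^ j * ?w (2 * j + 1)))"
      unfolding g_def by (rule padic_eq_1_mult_right[OF c1[OF that(1)]])
    also have "padic_eq 2 (1 * (d ^ j * ?w (2 * j + 1))) (d ^ j * y)"
      unfolding mult_1 using that(3) d0 by (intro padic_eq_mult_left) auto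
    finally show ?thesis .
  qed
  \<comment> \<open>For \<open>j = m + e * i\<close> with \<open>e = 1\<close> or
    \<open>e = -1\<close> the denominator is \<open>l = q + 2 * e * i\<close>. Dropping its summand
    \<open>q\<close> costs a product of two weights.\<close>
  have shift: "padic_eq 2 (?w l) (e * (?w i / 2))"
    if "l > 0" "\<not> q dvd l" "i \<in> {1..m}" "of_nat l = of_nat q + e * (2 * of_nat i)" "e = 1 \<or> e = - 1"
    for e :: "'p padic" and l i
  proof -
    have "(of_nat l :: 'p padic) \<noteq> 0" "(of_nat i :: 'p padic) \<noteq> 0" using that(1,3) by auto
    moreover have "e * of_nat l = e * of_nat q + 2 * of_nat i" using that(4,5) by auto
    moreover have "Q / L - e * (Q / I / 2) = - (e * (Q / L * (Q / I / 2)))"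
      if "L \<noteq> 0" "I \<noteq> 0" "e * L = e * Q + 2 * I" for Q L I :: "'p padic"
    proof -
      have "Q / L - e * (Q / I / 2) = Q * (2 * I - e * L) / (2 * L * I)"
        using that(1,2) by (simp add: field_simps)
      also have "\<dots> = - (e * (Q / L * (Q / I / 2)))" unfolding that(3) by (simp add: field_simps)
      finally show ?thesis .
    qed
    ultimately have "?w l - e * (?w i / 2) = - (e * (?w l * (?w i / 2)))" by blast
    moreover have "e \<in> padic_ideal 0" using that(5) by auto
    moreover have "?w i \<in> padic_ideal 1"
      using that(3) m by (intro q_divide_in_padic_ideal') auto
    ultimately show ?thesis
      unfolding padic_eq_def by (simp only:)
        (intro padic_ideal_uminus padic_ideal_mult_left[of e] padic_ideal_mult_1_1
          half_in_padic_ideal q_divide_in_padic_ideal[OF that(2)])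
  qed
  let ?R = "(1 - scaled_harmonic q m) * d ^ m
      - (\<Sum>i=1..m. ?w i * (d ^ (m - i) - d ^ (m + i))) / 2"
  have sides: "padic_eq 2 (g (m - i) + g (m + i)) (d ^ (m - i) * (- 1 * (?w i / 2)) + d ^ (m + i) * (1 * (?w i / 2)))"
    if i: "i \<in> {1..m}" for i
  proof -
    have "\<not> q dvd 2 * (m - i) + 1" using i m by (auto dest: dvd_imp_le)
    moreover have "\<not> q dvd 2 * (m + i) + 1"
    proof
      assume "q dvd 2 * (m + i) + 1"
      then have "q dvd 2 * (m + i) + 1 - q" by (rule dvd_diff_nat) simp
      then have "q dvd 2 * i" by (simp add: m)
      moreover have "odd q" by (simp add: m)
      ultimately have "q dvd i" by (simp add: coprime_dvd_mult_right_iff)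
      then show False using i m by (auto dest: dvd_imp_le)
    qed
    ultimately show ?thesis
      using i by (intro padic_eq_add side shift) (auto simp: m of_nat_diff algebra_simps)
  qed
  have "(\<Sum>j<q. g j) = g m + (\<Sum>i=1..m. g (m - i) + g (m + i))"
    unfolding m by (rule sum_symmetric_split)
  also have "padic_eq 2 \<dots> ((1 - scaled_harmonic q m) * d ^ m
      + (\<Sum>i=1..m. d ^ (m - i) * (- 1 * (?w i / 2)) + d ^ (m + i) * (1 * (?w i / 2))))"
  proof (rule padic_eq_add[OF _ padic_eq_sum[OF sides]])
    have "q \<noteq> 0" using m by simp
    then have "g m = ?c m * d ^ m" unfolding g_def m[symmetric] by simp
    moreover have "padic_eq 2 (?c m * d ^ m) ((1 - scaled_harmonic q m) * d ^ m)"
      using d0 m by (intro padic_eq_mult_right binomial_pred_padic_eq) auto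
    ultimately show "padic_eq 2 (g m) ((1 - scaled_harmonic q m) * d ^ m)" by simp
  qed
  also have "(\<Sum>i=1..m. d ^ (m - i) * (- 1 * (?w i / 2)) + d ^ (m + i) * (1 * (?w i / 2)))
      = - ((\<Sum>i=1..m. ?w i * (d ^ (m - i) - d ^ (m + i))) / 2)"
    unfolding sum_divide_distrib sum_negf[symmetric] by (intro sum.cong refl) (simp add: field_simps)
  finally have G: "padic_eq 2 (\<Sum>j<q. g j) ?R" by simp
  have "?R \<in> padic_ideal 0"
    using d0 m by (intro padic_ideal_diff padic_ideal_mult_right half_in_padic_ideal padic_ideal_sum
        padic_ideal_mult_left[of "?w _"] padic_ideal_1_imp_0[OF scaled_harmonic_in_padic_ideal]
        padic_ideal_1_imp_0[OF q_divide_in_padic_ideal']) auto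
  have "2 * 4 ^ (q - 1) * (\<Sum>k<q. of_nat (2 * k choose k) * x ^ k)
      = of_nat (2 * q choose q) * (\<Sum>j<q. g j)"
    using sum_central_binomial[OF _ d, of q] m
    by (simp add: g_def power_minus[of d] mult_ac)
  also have "padic_eq 2 \<dots> (2 * ?R)"
    using central_binomial_q G \<open>?R \<in> padic_ideal 0\<close> by (intro padic_eq_mult) auto
  finally have "padic_eq 2 (2 * (4 ^ (q - 1) * (\<Sum>k<q. of_nat (2 * k choose k) * x ^ k))) (2 * ?R)"
    by (simp only: mult.assoc)
  moreover have "padic_eq 2 y z" if "padic_eq 2 (2 * y) (2 * z)" for y z :: "'p padic"
    using half_in_padic_ideal[of "2 * y - 2 * z" 2] that by (simp add: padic_eq_def diff_divide_distrib)
  ultimately show ?thesis by blast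
qed

text \<open>The harmonic factor is divisible by \<open>p\<close>, so the central binomial
  coefficient may be replaced by \<open>(m choose k) * (-4) ^ k\<close>, which is 0 for
  \<open>k > m\<close>; the remaining sum is known exactly.\<close>

lemma sum_central_binomial_harmonic_padic_eq:
  assumes x: "(x :: 'p padic) \<in> padic_ideal 0" and d: "d = 1 - 4 * x"
  shows "padic_eq 2 (\<Sum>k<q. of_nat (2 * k choose k) * x ^ k * scaled_harmonic q k)
    (\<Sum>i=1..m. of_nat q / of_nat i * (d ^ m - d ^ (m - i)))"
proof -
  have "padic_eq 2 (of_nat (2 * k choose k) * x ^ k * scaled_harmonic q k)
      (of_nat (m choose k) * (- 4 * x) ^ k * scaled_harmonic q k)" if "k < q" for k
  proof -
    have "padic_eq 2 (of_nat (2 * k choose k) * (x ^ k * scaled_harmonic q k))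
        (of_nat (m choose k) * (- 4) ^ k * (x ^ k * scaled_harmonic q k))"
      using that x
      by (intro padic_eq_1_mult_right central_binomial_padic_eq padic_ideal_mult_left
          scaled_harmonic_in_padic_ideal) auto
    then show ?thesis by (simp only: power_mult_distrib mult.assoc)
  qed
  then have "padic_eq 2 (\<Sum>k<q. of_nat (2 * k choose k) * x ^ k * scaled_harmonic q k)
      (\<Sum>k<q. of_nat (m choose k) * (- 4 * x) ^ k * scaled_harmonic q k)"
    by (intro padic_eq_sum) auto
  also have "(\<Sum>k<q. of_nat (m choose k) * (- 4 * x) ^ k * scaled_harmonic q k)
      = (\<Sum>k\<le>m. of_nat (m choose k) * (- 4 * x) ^ k * scaled_harmonic q k)"
    by (rule sum.mono_neutral_right) (auto simp: m)
  also have "\<dots> = of_nat q * (\<Sum>k\<le>m. of_nat (m choose k) * (- 4 * x) ^ k * (\<Sum>j=1..k. 1 / of_nat j))"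
    by (simp add: sum_distrib_left mult_ac)
  also have "\<dots> = (\<Sum>i=1..m. of_nat q / of_nat i * (d ^ m - d ^ (m - i)))"
    unfolding sum_binomial_harmonic d by (simp add: sum_distrib_left)
  finally show ?thesis .
qed

text \<open>\<open>2 - 2 ^ q\<close> is congruent to a harmonic sum, each of whose terms is
  divisible by \<open>p\<close>.\<close>

lemma two_power_pred_in_padic_ideal: "2 ^ (q - 1) - 1 \<in> (padic_ideal 1 :: 'p padic set)"
proof -
  have "padic_eq 1 (2 - 2 ^ q) (scaled_harmonic q m :: 'p padic)"
    by (rule padic_eq_antimono[OF padic_eq_sym[OF scaled_harmonic_half]]) simp
  moreover have "scaled_harmonic q m \<in> (padic_ideal 1 :: 'p padic set)"
    by (rule scaled_harmonic_in_padic_ideal) (simp add: m)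
  ultimately have "2 - 2 ^ q \<in> (padic_ideal 1 :: 'p padic set)"
    using padic_ideal_add[of "2 - 2 ^ q - scaled_harmonic q m" 1 "scaled_harmonic q m :: 'p padic"]
    by (simp add: padic_eq_def)
  then have "- ((2 - 2 ^ q) / 2) \<in> (padic_ideal 1 :: 'p padic set)"
    by (intro padic_ideal_uminus half_in_padic_ideal)
  moreover have "- ((2 - 2 ^ q) / 2) = (2 ^ (q - 1) - 1 :: 'p padic)" by (simp add: m field_simps)
  ultimately show ?thesis by simp
qed

section \<open>The sum of the theorem modulo \<open>p^2\<close>\<close>

text \<open>Assembles \<open>A - h * B\<close> at \<open>x = h / 2\<close>. The factor
  \<open>4 ^ (q - 1) = (1 + t)^2\<close> is inverted by \<open>1 - 2 * t\<close>. The choice of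
  \<open>x\<close> gives \<open>d = 1 - 2 * h\<close>, so the coefficients \<open>-1/2\<close> and
  \<open>h\<close> of \<open>s1\<close> add up to \<open>-d/2\<close>.\<close>

lemma truncated_sum_padic_eq:
  assumes h: "(h :: 'p padic) \<in> padic_ideal 0" and d: "d = 1 - 2 * h" and t: "t = 2 ^ (q - 1) - 1"
  shows "padic_eq 2
    (\<Sum>k<q. ((h * of_nat q - 1) gchoose k) * of_nat (2 * k choose k) * (- (h / 2)) ^ k)
    (d ^ m * (1 + 2 * h * t) + (\<Sum>i=1..m. of_nat q / of_nat i * (d ^ (m + i) - d ^ (m + 1 - i))) / 2)"
proof -
  define x where "x = h / 2"
  have x: "x \<in> padic_ideal 0" unfolding x_def by (rule half_in_padic_ideal[OF h])
  have d0: "d \<in> padic_ideal 0" using d h by auto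
  have t1: "t \<in> padic_ideal 1" unfolding t by (rule two_power_pred_in_padic_ideal)
  define w where "w i = (of_nat q / of_nat i :: 'p padic)" for i
  define H where "H k = (\<Sum>i=1..k. w i)" for k
  have w1: "w i \<in> padic_ideal 1" if "i \<in> {1..m}" for i
    unfolding w_def using that m by (intro q_divide_in_padic_ideal') auto
  define A where "A = (\<Sum>k<q. of_nat (2 * k choose k) * x ^ k)"
  define B where "B = (\<Sum>k<q. of_nat (2 * k choose k) * x ^ k * H k)"
  define s1 where "s1 = (\<Sum>i=1..m. w i * d ^ (m - i))"
  define s2 where "s2 = (\<Sum>i=1..m. w i * d ^ (m + i))"
  define R where "R = (1 - H m) * d ^ m - (s1 - s2) / 2"
  have s: "s1 \<in> padic_ideal 1" "s2 \<in> padic_ideal 1"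
    unfolding s1_def s2_def using d0 w1 by (auto intro!: padic_ideal_sum padic_ideal_mult_right)
  have H1: "H m \<in> padic_ideal 1" unfolding H_def using w1 by (intro padic_ideal_sum)
  have R0: "R \<in> padic_ideal 0"
    unfolding R_def using d0 s H1 by (auto intro!: half_in_padic_ideal padic_ideal_mult_right)
  have A0: "A \<in> padic_ideal 0" unfolding A_def using x by (auto intro!: padic_ideal_sum)
  have "((h * of_nat q - 1) gchoose k) * of_nat (2 * k choose k) * (- (h / 2)) ^ k
      = ((- 1) ^ k * ((h * of_nat q - 1) gchoose k)) * (of_nat (2 * k choose k) * x ^ k)" for k
    by (simp add: x_def power_minus[of "h / 2"])
  then have "padic_eq 2
      (\<Sum>k<q. ((h * of_nat q - 1) gchoose k) * of_nat (2 * k choose k) * (- (h / 2)) ^ k)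
      (\<Sum>k<q. (1 - h * H k) * (of_nat (2 * k choose k) * x ^ k))"
    unfolding H_def w_def using x h
    by (simp only:) (intro padic_eq_sum padic_eq_mult_right gbinomial_padic_eq, auto)
  also have "(\<Sum>k<q. (1 - h * H k) * (of_nat (2 * k choose k) * x ^ k)) = A - h * B"
    unfolding A_def B_def by (simp add: sum_subtractf[symmetric] sum_distrib_left algebra_simps)
  also have "padic_eq 2 \<dots> ((1 - 2 * t) * R - h * (H m * d ^ m - s1))"
  proof (intro padic_eq_diff padic_eq_mult_left h)
    have "4 ^ (q - 1) = ((2 ^ (q - 1)) ^ 2 :: 'p padic)"
      by (simp add: power_mult[symmetric] mult.commute[of _ 2]) (simp add: power_mult)
    then have "4 ^ (q - 1) = (1 + t) ^ 2" by (simp add: t)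
    then have "A - (1 - 2 * t) * (4 ^ (q - 1) * A) = (t * t) * ((3 + 2 * t) * A)"
      by (simp add: algebra_simps power2_eq_square)
    also have "\<dots> \<in> padic_ideal 2"
      using t1 A0 by (intro padic_ideal_mult_right[OF padic_ideal_mult_1_1]) auto
    finally have "padic_eq 2 A ((1 - 2 * t) * (4 ^ (q - 1) * A))" by (simp only: padic_eq_def)
    also have "padic_eq 2 \<dots> ((1 - 2 * t) * R)"
    proof (rule padic_eq_mult_left)
      show "padic_eq 2 (4 ^ (q - 1) * A) R"
        using sum_central_binomial_padic_eq[OF x, of d] d
        by (simp add: A_def R_def s1_def s2_def H_def w_def x_def right_diff_distrib sum_subtractf)
      show "1 - 2 * t \<in> padic_ideal 0" using t1 by auto
    qed
    finally show "padic_eq 2 A ((1 - 2 * t) * R)" .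
    show "padic_eq 2 B (H m * d ^ m - s1)"
      using sum_central_binomial_harmonic_padic_eq[OF x, of d] d
      by (simp add: B_def s1_def H_def w_def x_def right_diff_distrib sum_subtractf sum_distrib_right)
  qed
  also have "padic_eq 2 \<dots> (d ^ m * (1 + 2 * h * t) + (s2 - d * s1) / 2)"
  proof -
    \<comment> \<open>The error in replacing \<open>H m\<close> by
      \<open>2 - 2 ^ q = -2 * t\<close>.\<close>
    define e where "e = H m + 2 * t"
    have "2 ^ q = (2 * 2 ^ (q - 1) :: 'p padic)" by (simp add: m)
    then have "e = H m - (2 - 2 ^ q)" by (simp add: e_def t algebra_simps)
    then have e: "e \<in> padic_ideal 2"
      using scaled_harmonic_half by (simp add: padic_eq_def H_def w_def)
    have H: "H m = e - 2 * t" by (simp add: e_def)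
    have "(1 - 2 * t) * R - h * (H m * d ^ m - s1) - (d ^ m * (1 + 2 * h * t) + (s2 - d * s1) / 2)
        = t * (s1 - s2) - d ^ m * (4 * (t * t) + (1 - 2 * t + h) * e)"
      unfolding R_def H d by (simp add: field_simps)
    also have "\<dots> \<in> padic_ideal 2"
      using t1 s e d0 h
      by (intro padic_ideal_diff padic_ideal_mult_1_1 padic_ideal_mult_left[of "d ^ m"] padic_ideal_add
          padic_ideal_mult_left[of 4] padic_ideal_mult_left[of "1 - 2 * t + h"]) auto
    finally show ?thesis by (simp only: padic_eq_def)
  qed
  also have "s2 - d * s1 = (\<Sum>i=1..m. of_nat q / of_nat i * (d ^ (m + i) - d ^ (m + 1 - i)))"
    unfolding s1_def s2_def sum_distrib_left sum_subtractf[symmetric]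
    by (intro sum.cong refl) (auto simp: w_def Suc_diff_le algebra_simps)
  finally show ?thesis .
qed

text \<open>For \<open>m \<ge> 2\<close> the power \<open>d ^ m\<close> contains \<open>d\<close>
  twice, and in the other sum a weight \<open>q / i\<close> meets positive powers of
  \<open>d\<close>. The value \<open>m = 1\<close> would be \<open>q = 3\<close>.\<close>

lemma truncated_sum_padic_eq_zero:
  assumes h: "(h :: 'p padic) \<in> padic_ideal 0" and d: "1 - 2 * h \<in> padic_ideal 1" and "m \<ge> 2"
  shows "padic_eq 2
    (\<Sum>k<q. ((h * of_nat q - 1) gchoose k) * of_nat (2 * k choose k) * (- (h / 2)) ^ k) 0"
proof -
  define d where "d = 1 - 2 * h"
  define t where "t = (2 ^ (q - 1) - 1 :: 'p padic)"
  have d1: "d \<in> padic_ideal 1" using d by (simp only: d_def)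
  have pow: "d ^ n \<in> padic_ideal 1" if "n \<ge> 1" for n
    using that d1 by (cases n) auto
  have "d ^ m = d * d ^ (m - 1)" using \<open>m \<ge> 2\<close> by (cases m) auto
  then have "d ^ m \<in> padic_ideal 2" using d1 pow[of "m - 1"] \<open>m \<ge> 2\<close> by auto
  moreover have "1 + 2 * h * t \<in> padic_ideal 0" using h unfolding t_def
    by (intro padic_ideal_add padic_ideal_mult_right padic_ideal_diff padic_ideal_power) auto
  moreover have "of_nat q / of_nat i * (d ^ (m + i) - d ^ (m + 1 - i)) \<in> padic_ideal 2" if "i \<in> {1..m}" for i
    using that m by (intro padic_ideal_mult_1_1 padic_ideal_diff pow q_divide_in_padic_ideal') auto
  ultimately have "d ^ m * (1 + 2 * h * t) \<in> padic_ideal 2"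
    "(\<Sum>i=1..m. of_nat q / of_nat i * (d ^ (m + i) - d ^ (m + 1 - i))) / 2 \<in> padic_ideal 2"
    by (blast intro: padic_ideal_mult_right half_in_padic_ideal padic_ideal_sum)+
  then have "d ^ m * (1 + 2 * h * t) + (\<Sum>i=1..m. of_nat q / of_nat i * (d ^ (m + i) - d ^ (m + 1 - i))) / 2
      \<in> padic_ideal 2" by (rule padic_ideal_add)
  then have "padic_eq 2 (d ^ m * (1 + 2 * h * t)
      + (\<Sum>i=1..m. of_nat q / of_nat i * (d ^ (m + i) - d ^ (m + 1 - i))) / 2) 0"
    by (simp add: padic_eq_def)
  with truncated_sum_padic_eq[OF h d_def t_def] show ?thesis by (rule padic_eq_trans)
qed

text \<open>Modulo \<open>p\<close>, Fermat's congruence raises the exponent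
  \<open>m + 1 - i\<close> by \<open>q - 1\<close> to \<open>m + (q - i)\<close>. Reflecting the
  weights then turns these terms into the upper half of a sum over all
  \<open>0 < i < q\<close>.\<close>

lemma half_sum_padic_eq:
  assumes d: "(d :: 'p padic) \<in> padic_ideal 0" and fermat: "d ^ (q - 1) - 1 \<in> padic_ideal 1"
  shows "padic_eq 2 (\<Sum>i=1..m. of_nat q / of_nat i * (d ^ (m + i) - d ^ (m + 1 - i)))
    (d ^ m * (1 - d ^ q - (1 - d) ^ q))"
proof -
  let ?w = "\<lambda>i. of_nat q / of_nat i :: 'p padic"
  have *: "{1..q-1} = {1..m} \<union> {m+1..q-1}" using m by auto
  have "(\<Sum>i=1..q-1. ?w i * d ^ i) = (\<Sum>i=1..m. ?w i * d ^ i) + (\<Sum>i=m+1..q-1. ?w i * d ^ i)"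
    unfolding * by (rule sum.union_disjoint) auto
  also have "(\<Sum>i=m+1..q-1. ?w i * d ^ i) = (\<Sum>i=1..m. ?w (q - i) * d ^ (q - i))"
    by (rule sum.reindex_bij_witness[of _ "\<lambda>i. q - i" "\<lambda>i. q - i"]) (auto simp: m)
  finally have split: "d ^ m * (\<Sum>i=1..q-1. ?w i * d ^ i)
      = (\<Sum>i=1..m. d ^ m * (?w i * d ^ i + ?w (q - i) * d ^ (q - i)))"
    by (simp add: sum.distrib[symmetric] sum_distrib_left)
  have "padic_eq 2 (?w i * (d ^ (m + i) - d ^ (m + 1 - i))) (d ^ m * (?w i * d ^ i + ?w (q - i) * d ^ (q - i)))"
    if i: "i \<in> {1..m}" for i
  proof -
    have w1: "?w i \<in> padic_ideal 1" using i m by (intro q_divide_in_padic_ideal') auto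
    have "padic_eq 2 (?w (q - i)) (- ?w i)" using i m by (intro q_divide_reflect) auto
    then have r: "?w (q - i) + ?w i \<in> padic_ideal 2" by (simp add: padic_eq_def)
    have "m + (q - i) = (m + 1 - i) + (q - 1)" using i m by auto
    then have *: "d ^ m * d ^ (q - i) = d ^ (m + 1 - i) * d ^ (q - 1)" by (metis power_add)
    have "?w i * (d ^ (m + i) - d ^ (m + 1 - i)) - d ^ m * (?w i * d ^ i + ?w (q - i) * d ^ (q - i))
        = ?w i * (d ^ m * d ^ (q - i) - d ^ (m + 1 - i)) - (?w (q - i) + ?w i) * (d ^ m * d ^ (q - i))"
      by (simp add: power_add algebra_simps)
    also have "\<dots> = d ^ (m + 1 - i) * (?w i * (d ^ (q - 1) - 1)) - (?w (q - i) + ?w i) * (d ^ m * d ^ (q - i))"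
      unfolding * by (simp add: algebra_simps)
    also have "\<dots> \<in> padic_ideal 2"
      using d by (intro padic_ideal_diff padic_ideal_mult_left[OF padic_ideal_power] padic_ideal_mult_1_1
          w1 fermat padic_ideal_mult_right[OF r]) auto
    finally show ?thesis by (simp only: padic_eq_def)
  qed
  then have "padic_eq 2 (\<Sum>i=1..m. ?w i * (d ^ (m + i) - d ^ (m + 1 - i)))
      (d ^ m * (\<Sum>i=1..q-1. ?w i * d ^ i))"
    unfolding split by (rule padic_eq_sum)
  also have "padic_eq 2 \<dots> (d ^ m * (1 - d ^ q - (1 - d) ^ q))"
    using d by (intro padic_eq_mult_left sum_q_divide_power) auto
  finally show ?thesis .
qed

text \<open>\<open>t\<close>, \<open>\<delta>\<close> and \<open>\<eta>\<close> measure how far the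
  powers of 2, \<open>d\<close> and \<open>h\<close> with exponent \<open>q - 1\<close> are from 1.
  All are divisible by \<open>p\<close>, so only linear terms in them survive.\<close>

lemma truncated_sum_padic_eq_unit:
  assumes h: "(h :: 'p padic) \<in> padic_ideal 0" and d: "d = 1 - 2 * h" and t: "t = 2 ^ (q - 1) - 1"
    and delta: "\<delta> = d ^ (q - 1) - 1" "\<delta> \<in> padic_ideal 1"
    and eta: "\<eta> = h ^ (q - 1) - 1" "\<eta> \<in> padic_ideal 1"
    and eps: "padic_eq 1 (d ^ m) \<epsilon>" "\<epsilon> = 1 \<or> \<epsilon> = - 1"
  shows "padic_eq 2
    (\<Sum>k<q. ((h * of_nat q - 1) gchoose k) * of_nat (2 * k choose k) * (- (h / 2)) ^ k)
    (\<epsilon> * (1 + h * (t + \<delta> - \<eta>)))"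
proof -
  have d0: "d \<in> padic_ideal 0" using d h by auto
  have t1: "t \<in> padic_ideal 1" unfolding t by (rule two_power_pred_in_padic_ideal)
  define c where "c = h * (t + \<delta> - \<eta>)"
  have c1: "c \<in> padic_ideal 1" unfolding c_def using h t1 delta(2) eta(2) by auto
  have e0: "\<epsilon> \<in> padic_ideal 0" using eps(2) by auto
  define G where "G = 1 + 2 * h * t + (1 - d ^ q - (1 - d) ^ q) / 2"
  have "q = Suc (q - 1)" using m by simp
  then have Suc: "x ^ q = x * x ^ (q - 1)" for x :: "'p padic" by (metis power_Suc)
  have powers: "d ^ q = d * (1 + \<delta>)" "(1 - d) ^ q = 2 * h * ((1 + t) * (1 + \<eta>))"
    unfolding Suc delta t eta by (simp_all add: d power_mult_distrib)
  \<comment> \<open>Because \<open>1 - d = 2 * h\<close>, the constants collapse to 1. The leftover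
    \<open>- \<delta> / 2\<close> is compensated by \<open>d ^ m\<close> below.\<close>
  then have G: "G = 1 + c - \<delta> / 2 - h * (t * \<eta>)"
    unfolding G_def c_def powers by (simp add: d field_simps)
  have G0: "G \<in> padic_ideal 0"
    unfolding G using c1 delta(2) h t1 eta(2) by (auto intro!: padic_ideal_diff half_in_padic_ideal)
  have "padic_eq 2 (\<Sum>k<q. ((h * of_nat q - 1) gchoose k) * of_nat (2 * k choose k) * (- (h / 2)) ^ k)
      (d ^ m * (1 + 2 * h * t) + (\<Sum>i=1..m. of_nat q / of_nat i * (d ^ (m + i) - d ^ (m + 1 - i))) / 2)"
    by (rule truncated_sum_padic_eq[OF h d t])
  also have "padic_eq 2 \<dots> (d ^ m * (1 + 2 * h * t) + d ^ m * (1 - d ^ q - (1 - d) ^ q) / 2)"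
    using half_in_padic_ideal[OF half_sum_padic_eq[unfolded padic_eq_def, of d]] d0 delta(1) delta(2)
    by (simp add: padic_eq_def diff_divide_distrib)
  also have "d ^ m * (1 + 2 * h * t) + d ^ m * (1 - d ^ q - (1 - d) ^ q) / 2 = d ^ m * G"
    by (simp add: G_def field_simps)
  also have "padic_eq 2 \<dots> (\<epsilon> * (1 + \<delta> / 2) * G)"
  proof (rule padic_eq_mult_right[OF _ G0])
    \<comment> \<open>A square root modulo \<open>p^2\<close>: squaring
      \<open>d ^ m = \<epsilon> + e\<close> gives
      \<open>\<delta> = 2 * \<epsilon> * e + e^2\<close>, which determines \<open>e\<close> up to
      \<open>p^2\<close>.\<close>
    define e where "e = d ^ m - \<epsilon>"
    have e1: "e \<in> padic_ideal 1" using eps by (simp only: padic_eq_def e_def)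
    have ee: "\<epsilon> * \<epsilon> = 1" using eps(2) by auto
    have "d ^ (q - 1) = d ^ m * d ^ m" by (simp add: m power_add[symmetric] mult_2)
    then have *: "\<delta> = 2 * (\<epsilon> * e) + e * e" using ee by (simp add: delta(1) e_def algebra_simps)
    have **: "d ^ m = \<epsilon> + e" by (simp add: e_def)
    have "d ^ m - \<epsilon> * (1 + \<delta> / 2) = e - (\<epsilon> * \<epsilon>) * e - \<epsilon> * (e * e) / 2"
      unfolding * ** by (simp add: field_simps)
    also have "\<dots> = - (\<epsilon> * (e * e) / 2)" by (simp add: ee)
    also have "\<dots> \<in> padic_ideal 2"
      by (intro padic_ideal_uminus half_in_padic_ideal padic_ideal_mult_left[OF e0]
          padic_ideal_mult_1_1 e1)
    finally show "padic_eq 2 (d ^ m) (\<epsilon> * (1 + \<delta> / 2))" by (simp only: padic_eq_def)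
  qed
  also have "padic_eq 2 \<dots> (\<epsilon> * (1 + c))"
  proof -
    have "\<epsilon> * (1 + \<delta> / 2) * G - \<epsilon> * (1 + c)
        = \<epsilon> * (\<delta> * c / 2 - \<delta> * \<delta> / 2 / 2 - t * \<eta> * (h * (1 + \<delta> / 2)))"
      unfolding G by (simp add: field_simps)
    also have "\<dots> \<in> padic_ideal 2"
      using e0 c1 delta(2) t1 eta(2) h
      by (intro padic_ideal_mult_left[OF e0] padic_ideal_diff half_in_padic_ideal padic_ideal_mult_1_1
          padic_ideal_mult_right[of "t * \<eta>"] padic_ideal_mult_left[OF h] padic_ideal_add
          padic_ideal_1_imp_0[of "\<delta> / 2"]) auto
    finally show ?thesis by (simp only: padic_eq_def)
  qed
  finally show ?thesis unfolding c_def .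
qed

end

subsection \<open>Fermat and Euler congruences\<close>

lemma padic_eq_1_Rep_padic_int:
  fixes u :: "'p::prime_card padic_int"
  shows "padic_eq 1 (to_fract u) (of_int (Rep_padic_int u 1))"
proof -
  have r: "Rep_padic_int u 1 mod int CARD('p) = Rep_padic_int u 1"
    using Rep_padic_int_mod[of 1 1 u] by simp
  then have "0 \<le> Rep_padic_int u 1"
    using prime_gt_0_int[OF prime_int_card[where 'p='p]] by (metis pos_mod_sign)
  then obtain k where k: "Rep_padic_int u 1 = int k" by (rule nonneg_int_cases)
  have "Rep_padic_int (u - of_nat k) 1 = 0"
    using r k by (simp add: minus_padic_int.rep_eq Rep_padic_int_of_nat mod_simps)
  then have "of_nat CARD('p) dvd (u - of_nat k)" by (simp add: padic_int_dvd_iff)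
  then obtain v where "u - of_nat k = of_nat CARD('p) * v" by (rule dvdE)
  then have "to_fract u - of_nat k = of_nat CARD('p) ^ 1 * to_fract v"
    by (metis power_one_right to_fract_diff to_fract_mult to_fract_of_nat)
  then show ?thesis unfolding padic_eq_def k of_int_of_nat_eq by (rule padic_idealI)
qed

lemma padic_eq_1_of_int:
  assumes "[x = y] (mod int CARD('p))"
  shows "padic_eq 1 (of_int x :: 'p::prime_card padic) (of_int y)"
proof -
  obtain z where "x - y = int CARD('p) * z"
    using assms by (auto simp: cong_iff_dvd_diff elim: dvdE)
  then have "(of_int x - of_int y :: 'p padic) = of_nat CARD('p) * of_int z"
    by (metis of_int_diff of_int_mult of_int_of_nat_eq)
  then show ?thesis
    unfolding padic_eq_def using padic_ideal_mult_right[OF prime_power_in_padic_ideal[of 1], of "of_int z"]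
    by simp
qed

lemma padic_euler_criterion:
  fixes u :: "'p::prime_card padic_int"
  assumes odd: "odd CARD('p)"
  shows "padic_eq 1 (to_fract u ^ ((CARD('p) - 1) div 2))
    (of_int (Legendre (Rep_padic_int u 1) (int CARD('p))))"
proof -
  let ?p = "CARD('p)"
  have "?p > 2" using odd prime_gt_1_nat[OF prime_card[where 'a='p]]
    by (cases "?p = 2") auto
  have "padic_eq 1 (to_fract u ^ ((?p - 1) div 2)) (of_int (Rep_padic_int u 1) ^ ((?p - 1) div 2))"
    by (intro padic_eq_power padic_eq_1_Rep_padic_int) auto
  also have "of_int (Rep_padic_int u 1) ^ ((?p - 1) div 2)
      = (of_int (Rep_padic_int u 1 ^ ((?p - 1) div 2)) :: 'p padic)" by simp
  also have "padic_eq 1 \<dots> (of_int (Legendre (Rep_padic_int u 1) (int ?p)))"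
    by (rule padic_eq_1_of_int[OF cong_sym[OF euler_criterion[OF prime_card \<open>?p > 2\<close>]]])
  finally show ?thesis .
qed

lemma Legendre_cases: "Legendre x p = 0 \<or> Legendre x p = 1 \<or> Legendre x p = - 1"
  by (simp add: Legendre_def)

text \<open>Induction through \<open>(p^(a+1) - 1)/2 = p * (p^a - 1)/2 + (p - 1)/2\<close>; raising
  to the odd power \<open>p\<close> fixes the values 0, 1 and -1.\<close>

lemma padic_euler_criterion_Jacobi:
  fixes u :: "'p::prime_card padic_int"
  assumes odd: "odd CARD('p)"
  shows "padic_eq 1 (to_fract u ^ ((CARD('p) ^ a - 1) div 2)) (of_int (padic_Jacobi u a))"
proof (induction a)
  case 0
  show ?case by (simp add: padic_Jacobi_def)
next
  case (Suc a)
  let ?p = "CARD('p)"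
  define L where "L = Legendre (Rep_padic_int u 1) (int ?p)"
  define r where "r = (?p - 1) div 2"
  define s where "s = (?p ^ a - 1) div 2"
  have p: "?p = 2 * r + 1" unfolding r_def using odd by (auto elim: oddE)
  have "odd (?p ^ a)" using odd by simp
  then have q: "?p ^ a = 2 * s + 1" unfolding s_def by (auto elim: oddE)
  have "?p ^ Suc a = ?p * (2 * s + 1)" by (simp only: power_Suc q)
  also have "\<dots> = 2 * (s * ?p + r) + 1" using p by (simp add: algebra_simps)
  finally have "?p ^ Suc a = 2 * (s * ?p + r) + 1" .
  then have "(?p ^ Suc a - 1) div 2 = s * ?p + r" by simp
  then have "to_fract u ^ ((?p ^ Suc a - 1) div 2) = (to_fract u ^ s) ^ ?p * to_fract u ^ r"
    by (simp add: power_add power_mult)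
  also have "padic_eq 1 \<dots> (of_int (L ^ a) ^ ?p * of_int L)"
  proof (intro padic_eq_mult padic_eq_power)
    show "padic_eq 1 (to_fract u ^ s) (of_int (L ^ a) :: 'p padic)"
      using Suc.IH by (simp only: padic_Jacobi_def s_def L_def)
    show "padic_eq 1 (to_fract u ^ r) (of_int L :: 'p padic)"
      unfolding r_def L_def by (rule padic_euler_criterion[OF odd])
  qed auto
  also have "of_int (L ^ a) ^ ?p * of_int L = (of_int (L ^ Suc a) :: 'p padic)"
  proof -
    have "L ^ ?p = L" using Legendre_cases[of "Rep_padic_int u 1" "int ?p"] odd p by (auto simp: L_def)
    then have "(L ^ a) ^ ?p = L ^ a" by (metis power_mult mult.commute)
    then show ?thesis by (metis of_int_mult of_int_power power_Suc mult.commute)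
  qed
  finally show ?case by (simp add: padic_Jacobi_def L_def)
qed

lemma padic_Legendre_unit:
  fixes u :: "'p::prime_card padic_int"
  assumes "\<not> of_nat CARD('p) dvd u"
  shows "Legendre (Rep_padic_int u 1) (int CARD('p)) = 1 \<or> Legendre (Rep_padic_int u 1) (int CARD('p)) = - 1"
proof -
  have "Rep_padic_int u 1 mod int CARD('p) \<noteq> 0"
    using assms Rep_padic_int_mod[of 1 1 u] by (simp add: padic_int_dvd_iff)
  then show ?thesis by (simp add: Legendre_def cong_def)
qed

lemma padic_fermat:
  fixes u :: "'p::prime_card padic_int"
  assumes odd: "odd CARD('p)" and u: "\<not> of_nat CARD('p) dvd u"
  shows "padic_eq 1 (to_fract u ^ (CARD('p) - 1)) 1"
proof -
  define r where "r = (CARD('p) - 1) div 2"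
  have "CARD('p) - 1 = r * 2" unfolding r_def using odd by (auto elim: oddE)
  then have "to_fract u ^ (CARD('p) - 1) = (to_fract u ^ r) ^ 2" by (simp add: power_mult)
  also have "padic_eq 1 \<dots> (of_int (Legendre (Rep_padic_int u 1) (int CARD('p))) ^ 2)"
    unfolding r_def by (intro padic_eq_power padic_euler_criterion[OF odd]) auto
  also have "of_int (Legendre (Rep_padic_int u 1) (int CARD('p))) ^ 2 = (1 :: 'p padic)"
    using padic_Legendre_unit[OF u] by auto
  finally show ?thesis .
qed

lemma prime_power_minus_one_factor:
  assumes "a > 0" "p > (0::nat)"
  shows "\<exists>c. p ^ a - 1 = (p - 1) * (1 + p * c)"
  using \<open>a > 0\<close>
proof (induction a rule: nat_induct_non_zero)
  case 1
  show ?case by (rule exI[of _ 0]) simp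
next
  case (Suc a)
  then obtain c where c: "p ^ a - 1 = (p - 1) * (1 + p * c)" by blast
  have "p ^ Suc a - 1 = p * (p ^ a - 1) + (p - 1)"
    using \<open>p > 0\<close> by (simp add: diff_mult_distrib2)
  also have "\<dots> = (p - 1) * (1 + p * (1 + p * c))" unfolding c by (simp add: algebra_simps)
  finally show ?case by blast
qed

text \<open>\<open>(p^a - 1)/(p - 1)\<close> is 1 modulo \<open>p\<close>, and raising
  \<open>1 + y\<close> with \<open>p\<close> dividing \<open>y\<close> to such an exponent changes
  it only by multiples of \<open>p * y\<close> modulo \<open>p^2\<close>.\<close>

lemma padic_power_prime_power_pred:
  fixes x :: "'p::prime_card padic"
  assumes "a > 0" and x: "padic_eq 1 (x ^ (CARD('p) - 1)) 1"
  shows "padic_eq 2 (x ^ (CARD('p) ^ a - 1)) (x ^ (CARD('p) - 1))"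
proof -
  obtain c where c: "CARD('p) ^ a - 1 = (CARD('p) - 1) * (1 + CARD('p) * c)"
    using prime_power_minus_one_factor[OF \<open>a > 0\<close>, of "CARD('p)"] by auto
  define y where "y = x ^ (CARD('p) - 1) - 1"
  have y: "y \<in> padic_ideal 1" using x by (simp add: padic_eq_def y_def)
  have "x ^ (CARD('p) ^ a - 1) = (1 + y) ^ (1 + CARD('p) * c)" unfolding c power_mult by (simp add: y_def)
  also have "padic_eq 2 \<dots> (1 + of_nat (1 + CARD('p) * c) * y)" by (rule one_plus_power_padic_eq[OF y])
  also have "padic_eq 2 \<dots> (1 + y)"
  proof -
    have "1 + of_nat (1 + CARD('p) * c) * y - (1 + y) = of_nat c * (of_nat (CARD('p) ^ 1) * y)"
      by (simp add: algebra_simps)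
    also have "\<dots> \<in> padic_ideal 2"
      by (intro padic_ideal_mult_left padic_ideal_mult_1_1 prime_power_in_padic_ideal y) simp
    finally show ?thesis by (simp only: padic_eq_def)
  qed
  finally show ?thesis by (simp add: y_def)
qed

section \<open>The congruence, by cases on whether \<open>p\<close> divides
  \<open>1 - 2h\<close>\<close>

theorem theorem1p1:
  fixes p a :: nat and h :: "'p::prime_card padic_int"
  assumes "p = CARD('p)" and "odd p" and "a > 0"
    and "\<not> padic_cong (to_fract h) 0 p"
    and "\<not> padic_cong (2 * to_fract h) 1 p \<or> p ^ a > 3"
  shows "padic_cong
    (\<Sum>k = 0..p ^ a - 1. ((to_fract h * of_nat (p ^ a) - 1) gchoose k)
        * of_nat ((2 * k) choose k) * (- (to_fract h / 2)) ^ k)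
    (of_int (padic_Jacobi (1 - 2 * h) a)
        * (1 + to_fract h * ((4 - 2 / to_fract h) ^ (p - 1) - 1)))
    (p ^ 2)"
proof -
  define q where "q = p ^ a"
  define m where "m = (q - 1) div 2"
  define H where "H = to_fract h"
  define d where "d = 1 - 2 * h"
  define D where "D = to_fract d"
  have odd: "odd CARD('p)" using assms by simp
  have "odd q" using \<open>odd p\<close> by (simp add: q_def)
  then have q: "q = 2 * m + 1" unfolding m_def by (auto elim: oddE)
  note ctx = odd q_def[unfolded \<open>p = CARD('p)\<close>] q
  have H0: "H \<in> padic_ideal 0" by (simp add: H_def)
  have D: "D = 1 - 2 * H" by (simp add: D_def d_def H_def)
  have cong_1: "padic_cong x y p \<longleftrightarrow> x - y \<in> padic_ideal 1" if "y \<in> padic_ideal 0" for x y :: "'p padic"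
    using padic_cong_iff_diff_in_padic_ideal[OF that, of x 1] \<open>p = CARD('p)\<close> by simp
  have dvd: "to_fract u \<in> padic_ideal 1" if dvd_u: "of_nat CARD('p) dvd u" for u :: "'p padic_int"
  proof -
    obtain v where "u = of_nat CARD('p) * v" using dvd_u by (rule dvdE)
    then have "to_fract u = of_nat CARD('p) ^ 1 * to_fract v" by simp
    then show ?thesis by (rule padic_idealI)
  qed
  have h: "\<not> of_nat CARD('p) dvd h" using dvd[of h] cong_1[of 0 "to_fract h"] assms(4) by auto
  have Hinv: "inverse H \<in> padic_ideal 0" unfolding H_def by (rule inverse_in_padic_ideal[OF h])
  have Hnz: "H \<noteq> 0" using h by (auto simp: H_def)
  define S where "S = (\<Sum>k<q. ((H * of_nat q - 1) gchoose k) * of_nat (2 * k choose k) * (- (H / 2)) ^ k)"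
  define R where "R = of_int (padic_Jacobi d a) * (1 + H * ((4 - 2 / H) ^ (p - 1) - 1))"
  have R0: "R \<in> padic_ideal 0"
    unfolding R_def divide_inverse using H0 Hinv
    by (intro padic_ideal_mult_right padic_ideal_add padic_ideal_diff padic_ideal_power) auto
  have "padic_eq 2 S R"
  proof (cases "of_nat CARD('p) dvd d")
    case True
    have "Rep_padic_int d 1 = 0" using True by (simp only: padic_int_dvd_iff)
    then have "Legendre (Rep_padic_int d 1) (int CARD('p)) = 0" by (simp add: Legendre_def)
    then have "R = 0" using \<open>a > 0\<close> by (simp add: R_def padic_Jacobi_def)
    have D1: "1 - 2 * H \<in> padic_ideal 1" using dvd[OF True] by (simp only: D_def[symmetric] D)
    then have "2 * H - 1 \<in> padic_ideal 1" using padic_ideal_uminus[OF D1] by simp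
    \<comment> \<open>Here \<open>2h\<close> is 1 modulo \<open>p\<close>, so the last hypothesis
      leaves only its second alternative.\<close>
    then have "p ^ a > 3" using assms(5) cong_1[of 1 "2 * H"] by (auto simp: H_def)
    then have "m \<ge> 2" using q by (simp add: q_def)
    show ?thesis unfolding S_def \<open>R = 0\<close>
      by (rule truncated_sum_padic_eq_zero[OF ctx H0 D1 \<open>m \<ge> 2\<close>])
  next
    case False
    have two: "\<not> of_nat CARD('p) dvd (2 :: 'p padic_int)"
      using of_nat_card_dvd_of_nat_iff[where 'p='p, of 2] odd_prime_card_not_dvd_2[OF odd]
      by (simp only: of_nat_numeral) simp
    \<comment> \<open>\<open>p\<close> times the Fermat quotient of \<open>x\<close>; it replaces
      the analogous term with exponent \<open>q - 1\<close>.\<close>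
    define F where "F x = x ^ (p - 1) - 1" for x :: "'p padic"
    define \<epsilon> where "\<epsilon> = (of_int (padic_Jacobi d a) :: 'p padic)"
    have fermat: "F (to_fract u) \<in> padic_ideal 1" if "\<not> of_nat CARD('p) dvd u" for u :: "'p padic_int"
      using padic_fermat[OF odd that] \<open>p = CARD('p)\<close> by (simp add: padic_eq_def F_def)
    have pow: "padic_eq 2 (to_fract u ^ (q - 1) - 1) (F (to_fract u))"
      if "\<not> of_nat CARD('p) dvd u" for u :: "'p padic_int"
      using padic_power_prime_power_pred[OF \<open>a > 0\<close> padic_fermat[OF odd that]] \<open>p = CARD('p)\<close>
      by (simp add: padic_eq_def F_def q_def)
    have fermat_q: "to_fract u ^ (q - 1) - 1 \<in> padic_ideal 1"
      if "\<not> of_nat CARD('p) dvd u" for u :: "'p padic_int"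
      using padic_ideal_add[OF padic_ideal_2_imp_1[OF pow[OF that, unfolded padic_eq_def]] fermat[OF that]]
      by simp
    have "padic_eq 1 (D ^ m) \<epsilon>"
      using padic_euler_criterion_Jacobi[OF odd, of d a] \<open>p = CARD('p)\<close>
      by (simp add: D_def \<epsilon>_def m_def q_def)
    moreover have eps: "\<epsilon> = 1 \<or> \<epsilon> = - 1"
    proof -
      consider "Legendre (Rep_padic_int d 1) (int CARD('p)) = 1" | "Legendre (Rep_padic_int d 1) (int CARD('p)) = - 1"
        using padic_Legendre_unit[OF False] by blast
      then show ?thesis
        by cases (simp_all add: \<epsilon>_def padic_Jacobi_def minus_one_power_iff)
    qed
    ultimately have "padic_eq 2 S (\<epsilon> * (1 + H * ((2 ^ (q - 1) - 1) + (D ^ (q - 1) - 1) - (H ^ (q - 1) - 1))))"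
      unfolding S_def using fermat_q[OF False] fermat_q[OF h]
      by (intro truncated_sum_padic_eq_unit[OF ctx H0 D refl refl _ refl]) (simp_all add: D_def H_def)
    also have "padic_eq 2 \<dots> (\<epsilon> * (1 + H * (F 2 + F D - F H)))"
      using pow[OF two] pow[OF False] pow[OF h] H0 eps
      by (intro padic_eq_mult_left padic_eq_add padic_eq_diff) (auto simp: D_def H_def)
    also have "padic_eq 2 \<dots> R"
    proof -
      have F1: "F 2 \<in> padic_ideal 1" "F D \<in> padic_ideal 1" "F H \<in> padic_ideal 1"
        using fermat[OF two] fermat[OF False] fermat[OF h] by (simp_all add: D_def H_def)
      \<comment> \<open>This factorization explains the base \<open>4 - 2/h\<close>: its Fermat
        quotient combines those of 2, \<open>D\<close> and \<open>H\<close>, and the sign disappears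
        since \<open>p - 1\<close> is even.\<close>
      have "4 - 2 / H = - (2 * D) * inverse H" using Hnz by (simp add: D field_simps)
      then have "(4 - 2 / H) ^ (p - 1) = (- (2 * D)) ^ (p - 1) * inverse H ^ (p - 1)"
        by (simp only: power_mult_distrib)
      also have "(- (2 * D)) ^ (p - 1) = (1 + F 2) * (1 + F D)"
        using \<open>odd p\<close> by (simp add: F_def power_mult_distrib)
      finally have base: "(4 - 2 / H) ^ (p - 1) = (1 + F 2) * (1 + F D) * inverse H ^ (p - 1)" .
      have inv: "(1 + F H) * inverse H ^ (p - 1) = 1"
        using Hnz by (simp add: F_def power_mult_distrib[symmetric])
      \<comment> \<open>Inserting the factor \<open>(1 + F H) * inverse H ^ (p - 1) = 1\<close>
        gives both parts a common denominator; the linear terms cancel, leaving products of two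
        multiples of \<open>p\<close>.\<close>
      have "F 2 + F D - F H - ((4 - 2 / H) ^ (p - 1) - 1)
          = (1 + (F 2 + F D - F H)) * ((1 + F H) * inverse H ^ (p - 1))
            - (1 + F 2) * (1 + F D) * inverse H ^ (p - 1)"
        unfolding inv base by simp
      also have "\<dots> = ((F 2 + F D - F H) * F H - F 2 * F D) * inverse H ^ (p - 1)"
        by (simp add: algebra_simps)
      also have "\<dots> \<in> padic_ideal 2"
        using F1 by (intro padic_ideal_mult_right[OF _ padic_ideal_power[OF Hinv]] padic_ideal_diff
            padic_ideal_mult_1_1 padic_ideal_add)
      finally have "padic_eq 2 (F 2 + F D - F H) ((4 - 2 / H) ^ (p - 1) - 1)" by (simp only: padic_eq_def)
      then show ?thesis
        unfolding R_def \<epsilon>_def using H0 by (intro padic_eq_mult_left padic_eq_add) auto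
    qed
    finally show ?thesis .
  qed
  then have "padic_cong S R (CARD('p) ^ 2)"
    using padic_cong_iff_diff_in_padic_ideal[OF R0, of S 2] by (simp add: padic_eq_def)
  moreover have "{0..q - 1} = {..<q}" using q by auto
  then have "{0..p ^ a - 1} = {..<q}" by (simp only: q_def)
  ultimately show ?thesis
    by (simp add: S_def R_def H_def d_def q_def \<open>p = CARD('p)\<close>)
qed

end
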